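(* Let $X$ be a complex infinite-dimensional Banach space and let $n\ge3$. Then $\mathcal{P}(^nX;\mathbb{C})$ fails the sequential $w^*$-KK.
   Context: $\mathcal{P}(^nX;\mathbb{C})$ is the Banach space of continuous complex-valued $n$-homogeneous polynomials on $X$ (maps $P(x)=\check P(x,\dots,x)$ with $\check P$ a continuous symmetric $n$-linear form), with norm $\|P\|=\sup_{x\in B_X}|P(x)|$. It is isometrically the dual of the completed symmetric projective tensor product $\widetilde\otimes_{\pi_s}^{n,s}X$ (the completion of the span of $\{x^{\otimes n}:x\in X\}$ under $\pi_s(u)=\inf\{\sum_j|\lambda_j|\|x_j\|^n:u=\sum_j\lambda_jx_j^{\otimes n}\}$), via $\langle P,x^{\otimes n}\rangle=P(x)$, and carries the corresponding weak-star topology (on bounded nets: pointwise convergence). A dual space $E^*$ with fixed predual $E$ has the sequential $w^*$-KK (sequential weak-star Kadec--Klee property) if, whenever $(x^*_m)\subseteq S_{E^*}$ is a sequence, $x^*\in S_{E^*}$ and $x^*_m\to x^*$ weak-star, then $\|x^*_m-x^*\|\to0$. *)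

theory Defs
  imports "HOL-Analysis.Analysis"
begin

class complex_normed_vector = real_normed_vector +
  fixes scaleC :: "complex \<Rightarrow> 'a \<Rightarrow> 'a" (infixr "*\<^sub>C" 75)
  assumes scaleC_add_right: "c *\<^sub>C (x + y) = c *\<^sub>C x + c *\<^sub>C y"
    and scaleC_add_left: "(c + d) *\<^sub>C x = c *\<^sub>C x + d *\<^sub>C x"
    and scaleC_scaleC: "c *\<^sub>C d *\<^sub>C x = (c * d) *\<^sub>C x"
    and scaleC_of_real: "complex_of_real r *\<^sub>C x = r *\<^sub>R x"
    and norm_scaleC: "norm (c *\<^sub>C x) = cmod c * norm x"

class complex_banach = complex_normed_vector + banach

lemma vector_space_scaleC:
  "vector_space (scaleC :: complex \<Rightarrow> 'a::complex_normed_vector \<Rightarrow> 'a)"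
proof
  show "1 *\<^sub>C x = x" for x :: 'a
    using scaleC_of_real[of 1 x] by simp
qed (simp_all add: scaleC_add_right scaleC_add_left scaleC_scaleC)

text \<open>An \<open>n\<close>-linear form takes as argument a family \<open>v :: nat \<Rightarrow> 'a\<close> of which it reads only the
  entries \<open>v 0, \<dots>, v (n - 1)\<close>. Continuity refers to the product topology on \<open>nat \<Rightarrow> 'a\<close>, which for
  such forms is joint continuity in the \<open>n\<close> arguments.\<close>

definition multilinear_form :: "nat \<Rightarrow> ((nat \<Rightarrow> 'a::complex_normed_vector) \<Rightarrow> complex) \<Rightarrow> bool" where
  "multilinear_form n A \<longleftrightarrow>
     (\<forall>v w. (\<forall>i<n. v i = w i) \<longrightarrow> A v = A w) \<and>
     (\<forall>i<n. \<forall>v. Vector_Spaces.linear scaleC (*) (\<lambda>x. A (v(i := x))))"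

definition symmetric_form :: "nat \<Rightarrow> ((nat \<Rightarrow> 'a::complex_normed_vector) \<Rightarrow> complex) \<Rightarrow> bool" where
  "symmetric_form n A \<longleftrightarrow> (\<forall>\<sigma> v. \<sigma> permutes {..<n} \<longrightarrow> A (v \<circ> \<sigma>) = A v)"

definition represents :: "nat \<Rightarrow> ((nat \<Rightarrow> 'a::complex_normed_vector) \<Rightarrow> complex) \<Rightarrow> ('a \<Rightarrow> complex) \<Rightarrow> bool" where
  "represents n A P \<longleftrightarrow> multilinear_form n A \<and> symmetric_form n A \<and> continuous_on UNIV A \<and>
     (\<forall>x. P x = A (\<lambda>_. x))"

definition hom_polys :: "nat \<Rightarrow> ('a::complex_normed_vector \<Rightarrow> complex) set" where
  "hom_polys n = {P. \<exists>A. represents n A P}"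

definition polar_form :: "nat \<Rightarrow> ('a::complex_normed_vector \<Rightarrow> complex) \<Rightarrow> (nat \<Rightarrow> 'a) \<Rightarrow> complex" where
  "polar_form n P = (SOME A. represents n A P)"

definition poly_norm :: "('a::complex_normed_vector \<Rightarrow> complex) \<Rightarrow> real" where
  "poly_norm P = (SUP x\<in>cball 0 1. cmod (P x))"

text \<open>Algebraic tensors are realised as linear functionals on the space of all \<open>n\<close>-linear forms;
  in particular \<open>x \<otimes> \<dots> \<otimes> x\<close> is the evaluation \<open>A \<mapsto> A (x, \<dots>, x)\<close>. The value \<open>0\<close> off the
  \<open>n\<close>-linear forms makes equality of functions the same as equality of tensors.\<close>

type_synonym 'a tensor = "((nat \<Rightarrow> 'a) \<Rightarrow> complex) \<Rightarrow> complex"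

definition tensor_power :: "nat \<Rightarrow> 'a::complex_normed_vector \<Rightarrow> 'a tensor" where
  "tensor_power n x = (\<lambda>A. if multilinear_form n A then A (\<lambda>_. x) else 0)"

definition tensor_sum ::
  "nat \<Rightarrow> nat \<Rightarrow> (nat \<Rightarrow> complex) \<Rightarrow> (nat \<Rightarrow> 'a::complex_normed_vector) \<Rightarrow> 'a tensor" where
  "tensor_sum n k c x = (\<lambda>A. \<Sum>j<k. c j * tensor_power n (x j) A)"

definition sym_tensors :: "nat \<Rightarrow> 'a::complex_normed_vector tensor set" where
  "sym_tensors n = {tensor_sum n k c x | k c x. True}"

definition proj_norm :: "nat \<Rightarrow> 'a::complex_normed_vector tensor \<Rightarrow> real" where
  "proj_norm n u = Inf {\<Sum>j<k. cmod (c j) * norm (x j) ^ n | k c x. u = tensor_sum n k c x}"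

text \<open>The completion, as classes of Cauchy sequences modulo null sequences.\<close>

definition cauchy_tensors :: "nat \<Rightarrow> (nat \<Rightarrow> 'a::complex_normed_vector tensor) set" where
  "cauchy_tensors n = {u. (\<forall>k. u k \<in> sym_tensors n) \<and>
     (\<forall>e>0. \<exists>N. \<forall>k\<ge>N. \<forall>l\<ge>N. proj_norm n (u k - u l) < e)}"

definition completed_sym_tensors :: "nat \<Rightarrow> (nat \<Rightarrow> 'a::complex_normed_vector tensor) set set" where
  "completed_sym_tensors n = cauchy_tensors n //
     {(u, v). u \<in> cauchy_tensors n \<and> v \<in> cauchy_tensors n \<and>
              (\<lambda>k. proj_norm n (u k - v k)) \<longlonglongrightarrow> 0}"

text \<open>The continuous extension to the completion of \<open>u \<mapsto> \<langle>P, u\<rangle> = u (polar_form n P)\<close>, that is, of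
  the linear functional with \<open>\<langle>P, x \<otimes> \<dots> \<otimes> x\<rangle> = P x\<close>; see \<open>eval_tensor_sum\<close> and
  \<open>poly_pairing_limit\<close> below.\<close>

definition poly_pairing ::
  "nat \<Rightarrow> ('a::complex_normed_vector \<Rightarrow> complex) \<Rightarrow> (nat \<Rightarrow> 'a tensor) set \<Rightarrow> complex" where
  "poly_pairing n P U = (THE c. \<forall>u\<in>U. (\<lambda>k. u k (polar_form n P)) \<longlonglongrightarrow> c)"

text \<open>\<open>D\<close> with norm \<open>nrm\<close> is the dual of \<open>E\<close> through the pairing \<open>pair\<close>.\<close>

definition sequential_wstar_KK ::
  "'d::minus set \<Rightarrow> ('d \<Rightarrow> real) \<Rightarrow> 'e set \<Rightarrow> ('d \<Rightarrow> 'e \<Rightarrow> complex) \<Rightarrow> bool" where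
  "sequential_wstar_KK D nrm E pair \<longleftrightarrow>
     (\<forall>f g. (\<forall>m. f m \<in> D \<and> nrm (f m) = 1) \<longrightarrow> g \<in> D \<and> nrm g = 1 \<longrightarrow>
        (\<forall>u\<in>E. (\<lambda>m. pair (f m) u) \<longlonglongrightarrow> pair g u) \<longrightarrow>
        (\<lambda>m::nat. nrm (f m - g)) \<longlonglongrightarrow> 0)"

lemma represents_polar_form: "P \<in> hom_polys n \<Longrightarrow> represents n (polar_form n P) P"
  unfolding hom_polys_def polar_form_def by (drule CollectD) (erule someI_ex[where P = "\<lambda>A. represents n A P"])

lemma eval_tensor_sum:
  assumes "P \<in> hom_polys n"
  shows "tensor_sum n k c x (polar_form n P) = (\<Sum>j<k. c j * P (x j))"
  using represents_polar_form[OF assms]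
  by (simp add: tensor_sum_def tensor_power_def represents_def)

lemma multilinear_form_scaleC:
  assumes "multilinear_form n A"
  shows "A (\<lambda>_. c *\<^sub>C x) = c ^ n * A (\<lambda>_. x)"
proof -
  have step: "A (v(i := c *\<^sub>C y)) = c * A (v(i := y))" if "i < n" for v i y
  proof -
    have "Vector_Spaces.linear scaleC (*) (\<lambda>x. A (v(i := x)))"
      using assms that unfolding multilinear_form_def by blast
    then show ?thesis
      by (simp add: Vector_Spaces.linear_iff)
  qed
  have "A (\<lambda>i. if i < m then c *\<^sub>C x else x) = c ^ m * A (\<lambda>_. x)" if "m \<le> n" for m
    using that
  proof (induction m)
    case (Suc m)
    let ?v = "\<lambda>i. if i < m then c *\<^sub>C x else x"
    have "(\<lambda>i. if i < Suc m then c *\<^sub>C x else x) = ?v(m := c *\<^sub>C x)" "?v(m := x) = ?v"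
      by (auto simp: fun_eq_iff)
    then show ?case
      using step[of m ?v x] Suc by simp
  qed simp
  from this[of n] have "A (\<lambda>i. if i < n then c *\<^sub>C x else x) = c ^ n * A (\<lambda>_. x)"
    by simp
  moreover have "A (\<lambda>i. if i < n then c *\<^sub>C x else x) = A (\<lambda>_. c *\<^sub>C x)"
    using assms unfolding multilinear_form_def by auto
  ultimately show ?thesis by simp
qed

lemma hom_polys_scaleC: "P \<in> hom_polys n \<Longrightarrow> P (c *\<^sub>C x) = c ^ n * P x"
  using multilinear_form_scaleC unfolding hom_polys_def represents_def by auto

lemma continuous_on_hom_polys:
  assumes "P \<in> hom_polys n"
  shows "continuous_on UNIV P"
proof -
  obtain A where "represents n A P"
    using assms unfolding hom_polys_def by blast
  then have A: "continuous_on UNIV A" "\<And>x. P x = A (\<lambda>_. x)"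
    unfolding represents_def by simp_all
  have "continuous_on UNIV (\<lambda>x::'a. (\<lambda>_::nat. x))"
    by (intro continuous_on_coordinatewise_then_product continuous_on_id)
  from continuous_on_compose2[OF A(1) this] have "continuous_on UNIV (\<lambda>x. A (\<lambda>_. x))"
    by simp
  moreover have "P = (\<lambda>x. A (\<lambda>_. x))"
    by (rule ext) (rule A(2))
  ultimately show ?thesis by simp
qed

lemma bdd_above_poly_norm:
  fixes P :: "'a::complex_normed_vector \<Rightarrow> complex"
  assumes "P \<in> hom_polys n"
  shows "bdd_above ((\<lambda>x. cmod (P x)) ` cball 0 1)"
proof -
  have "isCont P 0"
    using continuous_on_hom_polys[OF assms] by (simp add: continuous_on_eq_continuous_at)
  then obtain d where d: "d > 0" "\<And>x. dist x 0 < d \<Longrightarrow> dist (P x) (P 0) < 1"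
    unfolding continuous_at_eps_delta using zero_less_one by blast
  have "cmod (P x) \<le> (1 + cmod (P 0)) * (2 / d) ^ n" if "x \<in> cball 0 1" for x
  proof -
    have "norm ((d / 2) *\<^sub>R x) \<le> d / 2"
      using d(1) that by (simp add: mult_le_cancel_left1)
    then have "dist (P ((d / 2) *\<^sub>R x)) (P 0) < 1"
      using d(1) by (intro d(2)) (simp add: dist_norm)
    then have "cmod (P ((d / 2) *\<^sub>R x)) \<le> 1 + cmod (P 0)"
      using norm_triangle_ineq2[of "P ((d / 2) *\<^sub>R x)" "P 0"] by (simp add: dist_norm)
    moreover have "P ((d / 2) *\<^sub>R x) = complex_of_real (d / 2) ^ n * P x"
      using hom_polys_scaleC[OF assms, of "complex_of_real (d / 2)" x] unfolding scaleC_of_real .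
    ultimately have "(d / 2) ^ n * cmod (P x) \<le> 1 + cmod (P 0)"
      using d(1) by (simp add: norm_mult norm_power norm_divide)
    then show ?thesis
      using d(1) by (simp add: field_simps)
  qed
  then show ?thesis
    by (intro bdd_aboveI2[where M = "(1 + cmod (P 0)) * (2 / d) ^ n"])
qed

lemma hom_polys_bound:
  fixes P :: "'a::complex_normed_vector \<Rightarrow> complex"
  assumes "P \<in> hom_polys n"
  shows "cmod (P x) \<le> poly_norm P * norm x ^ n"
proof -
  have ball: "cmod (P y) \<le> poly_norm P" if "norm y \<le> 1" for y
    unfolding poly_norm_def using that bdd_above_poly_norm[OF assms]
    by (intro cSUP_upper) auto
  have hom: "cmod (P (r *\<^sub>R y)) = \<bar>r\<bar> ^ n * cmod (P y)" for r y
    using hom_polys_scaleC[OF assms, of "complex_of_real r" y]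
    by (simp add: scaleC_of_real norm_mult norm_power)
  show ?thesis
  proof (cases "x = 0")
    case True
    then show ?thesis
      using hom[of 0 0] ball[of 0] by (cases "n = 0") (auto simp: power_0_left)
  next
    case False
    then have "cmod (P x) = norm x ^ n * cmod (P ((1 / norm x) *\<^sub>R x))"
      using hom[of "norm x" "(1 / norm x) *\<^sub>R x"] by simp
    also have "\<dots> \<le> norm x ^ n * poly_norm P"
      using False by (intro mult_left_mono ball) auto
    finally show ?thesis by (simp add: mult.commute)
  qed
qed

lemma poly_norm_nonneg: "P \<in> hom_polys n \<Longrightarrow> 0 \<le> poly_norm P"
  unfolding poly_norm_def
  by (rule cSUP_upper2[OF bdd_above_poly_norm, where x = 0]) auto

lemma eval_tensor_bound:
  fixes P :: "'a::complex_normed_vector \<Rightarrow> complex"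
  assumes P: "P \<in> hom_polys n" and u: "u \<in> sym_tensors n"
  shows "cmod (u (polar_form n P)) \<le> poly_norm P * proj_norm n u"
proof -
  let ?S = "{\<Sum>j<k. cmod (c j) * norm (x j) ^ n | k c x. u = tensor_sum n k c x}"
  have le: "cmod (u (polar_form n P)) \<le> poly_norm P * s" if s_in: "s \<in> ?S" for s
  proof -
    obtain k c x where s: "s = (\<Sum>j<k. cmod (c j) * norm (x j) ^ n)" "u = tensor_sum n k c x"
      using s_in by blast
    have "cmod (u (polar_form n P)) \<le> (\<Sum>j<k. cmod (c j * P (x j)))"
      unfolding s(2) eval_tensor_sum[OF P] by (rule norm_sum)
    also have "\<dots> \<le> (\<Sum>j<k. cmod (c j) * (poly_norm P * norm (x j) ^ n))"
      by (intro sum_mono) (simp add: norm_mult mult_left_mono hom_polys_bound[OF P])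
    finally show ?thesis
      by (simp add: s(1) sum_distrib_left mult_ac)
  qed
  obtain s where s: "s \<in> ?S" using u unfolding sym_tensors_def by blast
  show ?thesis
  proof (cases "poly_norm P = 0")
    case True
    then show ?thesis using le[OF s] by simp
  next
    case False
    then have pos: "poly_norm P > 0" using poly_norm_nonneg[OF P] by simp
    have "cmod (u (polar_form n P)) / poly_norm P \<le> Inf ?S"
      using s le pos by (intro cInf_greatest) (auto simp: field_simps)
    then show ?thesis
      using pos by (simp add: proj_norm_def field_simps)
  qed
qed

lemma sym_tensors_diff:
  assumes "u \<in> sym_tensors n" "v \<in> sym_tensors n"
  shows "u - v \<in> sym_tensors n"
proof -
  obtain k c x l d y where u: "u = tensor_sum n k c x" and v: "v = tensor_sum n l d y"
    using assms unfolding sym_tensors_def by blast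
  have "u - v = tensor_sum n (k + l) (\<lambda>j. if j < k then c j else - d (j - k))
                  (\<lambda>j. if j < k then x j else y (j - k))"
  proof
    fix A
    have split: "(\<Sum>j<k + l. h j) = (\<Sum>j<k. h j) + (\<Sum>j<l. h (k + j))" for h :: "nat \<Rightarrow> complex"
      by (induction l) (simp_all add: add.assoc)
    show "(u - v) A = tensor_sum n (k + l) (\<lambda>j. if j < k then c j else - d (j - k))
                  (\<lambda>j. if j < k then x j else y (j - k)) A"
      by (simp add: u v tensor_sum_def split sum_negf)
  qed
  then show ?thesis unfolding sym_tensors_def by blast
qed

lemma proj_norm_zero: "proj_norm n (\<lambda>_. 0) = 0"
  unfolding proj_norm_def
proof (rule cInf_eq_minimum)
  show "0 \<in> {\<Sum>j<k. cmod (c j) * norm (x j) ^ n | k c x. (\<lambda>_. 0) = tensor_sum n k c x}"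
    by (rule CollectI, rule exI[of _ 0]) (auto simp: tensor_sum_def)
qed (auto intro!: sum_nonneg)

lemma poly_pairing_limit:
  fixes P :: "'a::complex_normed_vector \<Rightarrow> complex"
  assumes P: "P \<in> hom_polys n" and U: "U \<in> completed_sym_tensors n" and u: "u \<in> U"
  shows "(\<lambda>k. u k (polar_form n P)) \<longlonglongrightarrow> poly_pairing n P U"
proof -
  let ?ev = "\<lambda>u k. u k (polar_form n P)"
  obtain w where w: "w \<in> cauchy_tensors n"
    and Uw: "U = {v. v \<in> cauchy_tensors n \<and> (\<lambda>k. proj_norm n (w k - v k)) \<longlonglongrightarrow> 0}"
    using U unfolding completed_sym_tensors_def by (auto elim!: quotientE)
  have mem: "v k \<in> sym_tensors n" if "v \<in> cauchy_tensors n" for v k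
    using that by (simp add: cauchy_tensors_def)
  have "Cauchy (?ev w)"
  proof (rule metric_CauchyI)
    fix e :: real
    assume e: "e > 0"
    have pos: "poly_norm P + 1 > 0" using poly_norm_nonneg[OF P] by simp
    then have "e / (poly_norm P + 1) > 0" using e by simp
    then obtain N where N: "\<And>k l. k \<ge> N \<Longrightarrow> l \<ge> N \<Longrightarrow> proj_norm n (w k - w l) < e / (poly_norm P + 1)"
      using w unfolding cauchy_tensors_def by blast
    have "dist (?ev w k) (?ev w l) < e" if "k \<ge> N" "l \<ge> N" for k l
    proof -
      have "dist (?ev w k) (?ev w l) \<le> poly_norm P * proj_norm n (w k - w l)"
        using eval_tensor_bound[OF P sym_tensors_diff[OF mem[OF w, of k] mem[OF w, of l]]]
        by (simp add: dist_norm)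
      also have "\<dots> \<le> poly_norm P * (e / (poly_norm P + 1))"
        using N[OF that] poly_norm_nonneg[OF P] by (intro mult_left_mono) auto
      also have "\<dots> < e" using e pos by (simp add: field_simps)
      finally show ?thesis .
    qed
    then show "\<exists>N. \<forall>k\<ge>N. \<forall>l\<ge>N. dist (?ev w k) (?ev w l) < e" by blast
  qed
  then obtain c where c: "?ev w \<longlonglongrightarrow> c"
    using Cauchy_convergent convergent_def by blast
  have lim: "?ev v \<longlonglongrightarrow> c" if "v \<in> U" for v
  proof -
    have v: "v \<in> cauchy_tensors n" "(\<lambda>k. proj_norm n (w k - v k)) \<longlonglongrightarrow> 0"
      using that Uw by auto
    have "cmod (?ev w k - ?ev v k) \<le> poly_norm P * proj_norm n (w k - v k)" for k
      using eval_tensor_bound[OF P sym_tensors_diff[OF mem[OF w, of k] mem[OF v(1), of k]]] by simp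
    moreover have "(\<lambda>k. poly_norm P * proj_norm n (w k - v k)) \<longlonglongrightarrow> 0"
      using tendsto_mult_left[OF v(2), of "poly_norm P"] by simp
    ultimately have "(\<lambda>k. ?ev w k - ?ev v k) \<longlonglongrightarrow> 0"
      by (rule Lim_null_comparison[OF always_eventually[OF allI]])
    from tendsto_diff[OF c this] show ?thesis by simp
  qed
  have "poly_pairing n P U = c"
    unfolding poly_pairing_def
    using lim u by (intro the_equality) (auto intro: LIMSEQ_unique)
  then show ?thesis using lim[OF u] by simp
qed

end

theory Submission
  imports Defs "HOL-Library.Diagonal_Subsequence"
begin

text \<open>
  Scale and rotate two independent functionals so that the ellipsoid
  \<open>\<bar>L x\<bar>\<^sup>2 + \<bar>M x\<bar>\<^sup>2 \<le> 1\<close> contains the unit ball and touches it in the direction of \<open>L\<close>. By the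
  Josefson--Nissenzweig theorem there is a weak-star null sequence \<open>\<phi>\<^sub>m\<close> of functionals of norm at
  most \<open>1\<close> and bounded away from \<open>0\<close>. The polynomials \<open>L\<^sup>n + M\<^sup>2 \<phi>\<^sub>m\<^sup>n\<^sup>-\<^sup>2\<close> have norm \<open>1\<close>, because
  \<open>\<bar>L\<bar>\<^sup>2 + \<bar>M\<bar>\<^sup>2 \<le> 1\<close> on the ball, and they converge pointwise to \<open>L\<^sup>n\<close> since \<open>n \<ge> 3\<close>, but not in norm.

  For the Josefson--Nissenzweig theorem, suppose that there is no such sequence. A bounded sequence
  in the dual all of whose convex blocks oscillate would produce one through Rademacher averages and
  Bessel's inequality, so every bounded sequence has norm convergent convex blocks. Then a bounded
  sequence that converges on a countable norming set converges everywhere: two different limits at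
  a point would come from two norm limits of convex blocks that agree on the norming set. Applied
  to a norm separated sequence this contradicts the assumption.
\<close>

section \<open>The Hahn--Banach theorem\<close>

definition sublinear :: "('a::real_vector \<Rightarrow> real) \<Rightarrow> bool" where
  "sublinear p \<longleftrightarrow> (\<forall>x y. p (x + y) \<le> p x + p y) \<and> (\<forall>t x. 0 \<le> t \<longrightarrow> p (t *\<^sub>R x) = t * p x)"

lemma sublinear_add: "sublinear p \<Longrightarrow> p (x + y) \<le> p x + p y"
  and sublinear_scaleR: "sublinear p \<Longrightarrow> 0 \<le> t \<Longrightarrow> p (t *\<^sub>R x) = t * p x"
  by (auto simp: sublinear_def)

lemma sublinear_zero: "sublinear p \<Longrightarrow> p 0 = 0"
  using sublinear_scaleR[of p 0 0] by simp

text \<open>The inequality with \<open>1 / t\<close> at the point \<open>t *\<^sub>R x\<close>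
  yields the reverse one.\<close>

lemma sublinearI:
  assumes add: "\<And>x y. p (x + y) \<le> p x + p y"
    and le: "\<And>t x. 0 < t \<Longrightarrow> p (t *\<^sub>R x) \<le> t * p x"
    and zero: "p 0 = 0"
  shows "sublinear p"
proof -
  have "p (t *\<^sub>R x) = t * p x" if "0 \<le> t" for t x
  proof (cases "t = 0")
    case False
    then have t: "t > 0" using that by simp
    have "p ((1 / t) *\<^sub>R (t *\<^sub>R x)) \<le> (1 / t) * p (t *\<^sub>R x)"
      using t by (intro le) simp
    then have "t * p x \<le> p (t *\<^sub>R x)" using t by (simp add: field_simps)
    with le[OF t, of x] show ?thesis by simp
  qed (simp add: zero)
  with add show ?thesis by (simp add: sublinear_def)
qed

text \<open>If \<open>q\<close> is minimal among the sublinear functionals, then \<open>slide q x = q\<close>, so that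
  \<open>slide_minus\<close> gives \<open>q (- x) \<le> - q x\<close> and \<open>q\<close> is linear.\<close>

definition slide :: "('a::real_vector \<Rightarrow> real) \<Rightarrow> 'a \<Rightarrow> 'a \<Rightarrow> real" where
  "slide q x y = (INF t\<in>{0..}. q (y + t *\<^sub>R x) - t * q x)"

text \<open>Bounds the family in \<open>slide\<close> from below independently of \<open>t\<close>,
  so that its infimum is finite.\<close>

lemma slide_lower:
  assumes "sublinear q" "0 \<le> t"
  shows "- q (- y) \<le> q (y + t *\<^sub>R x) - t * q x"
  using sublinear_add[OF assms(1), of "y + t *\<^sub>R x" "- y"] sublinear_scaleR[OF assms, of x]
  by simp

lemma slide_le:
  assumes "sublinear q" "0 \<le> t"
  shows "slide q x y \<le> q (y + t *\<^sub>R x) - t * q x"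
  unfolding slide_def using assms slide_lower[OF assms(1)]
  by (intro cINF_lower bdd_belowI2[where m = "- q (- y)"]) auto

lemma slide_greatest:
  assumes "\<And>t. 0 \<le> t \<Longrightarrow> c \<le> q (y + t *\<^sub>R x) - t * q x"
  shows "c \<le> slide q x y"
  unfolding slide_def using assms by (intro cINF_greatest) auto

lemma slide_le_self: "sublinear q \<Longrightarrow> slide q x y \<le> q y"
  using slide_le[of q 0 x y] by simp

lemma slide_minus: "sublinear q \<Longrightarrow> slide q x (- x) \<le> - q x"
  using slide_le[of q 1 x "- x"] by (simp add: sublinear_zero)

lemma sublinear_slide:
  assumes q: "sublinear q"
  shows "sublinear (slide q x)"
proof (rule sublinearI)
  fix y z
  \<comment> \<open>The parameter \<open>t + s\<close> is admissible for \<open>y + z\<close>; the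
    infima over \<open>s\<close> and over \<open>t\<close> are then taken one after the
    other.\<close>
  have "slide q x (y + z) - (q (y + t *\<^sub>R x) - t * q x) \<le> q (z + s *\<^sub>R x) - s * q x"
    if "0 \<le> s" "0 \<le> t" for s t
  proof -
    have "slide q x (y + z) \<le> q (y + z + (t + s) *\<^sub>R x) - (t + s) * q x"
      using that by (intro slide_le[OF q]) simp
    also have "q (y + z + (t + s) *\<^sub>R x) \<le> q (y + t *\<^sub>R x) + q (z + s *\<^sub>R x)"
      using sublinear_add[OF q, of "y + t *\<^sub>R x" "z + s *\<^sub>R x"] by (simp add: algebra_simps)
    finally show ?thesis by (simp add: algebra_simps)
  qed
  then have "slide q x (y + z) - (q (y + t *\<^sub>R x) - t * q x) \<le> slide q x z" if "0 \<le> t" for t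
    using that by (intro slide_greatest) auto
  then have "slide q x (y + z) - slide q x z \<le> slide q x y"
    by (intro slide_greatest) (simp add: algebra_simps)
  then show "slide q x (y + z) \<le> slide q x y + slide q x z" by simp
next
  fix t :: real and y
  assume t: "0 < t"
  have "slide q x (t *\<^sub>R y) / t \<le> slide q x y"
  proof (rule slide_greatest)
    fix s :: real
    assume s: "0 \<le> s"
    have "slide q x (t *\<^sub>R y) \<le> q (t *\<^sub>R y + (t * s) *\<^sub>R x) - (t * s) * q x"
      using s t by (intro slide_le[OF q]) simp
    also have "q (t *\<^sub>R y + (t * s) *\<^sub>R x) = t * q (y + s *\<^sub>R x)"
      using sublinear_scaleR[OF q, of t "y + s *\<^sub>R x"] t by (simp add: scaleR_add_right)
    finally show "slide q x (t *\<^sub>R y) / t \<le> q (y + s *\<^sub>R x) - s * q x"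
      using t by (simp add: field_simps)
  qed
  then show "slide q x (t *\<^sub>R y) \<le> t * slide q x y"
    using t by (simp add: field_simps)
next
  have "0 \<le> slide q x 0"
    using slide_lower[OF q, of _ 0 x] sublinear_zero[OF q] by (intro slide_greatest) auto
  with slide_le_self[OF q, of x 0] sublinear_zero[OF q] show "slide q x 0 = 0" by simp
qed

text \<open>Zorn's lemma yields a minimal sublinear \<open>m\<close> below \<open>p\<close>. Since
  \<open>slide m x\<close> lies below \<open>m\<close>, minimality makes them equal; hence
  \<open>m\<close> is odd, and an odd sublinear functional is linear.\<close>

lemma linear_below_sublinear:
  assumes p: "sublinear p"
  shows "\<exists>f. linear f \<and> (\<forall>x. f x \<le> p x)"
proof -
  define A where "A = {q. sublinear q \<and> q \<le> p}"
  \<comment> \<open>A lower bound common to all members of \<open>A\<close>; it keeps the pointwise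
    infimum of a chain finite.\<close>
  have lower: "- p (- x) \<le> q x" if "q \<in> A" for q x
  proof -
    have "0 \<le> q x + q (- x)"
      using that sublinear_add[of q x "- x"] sublinear_zero[of q] by (simp add: A_def)
    moreover have "q (- x) \<le> p (- x)" using that by (simp add: A_def le_fun_def)
    ultimately show ?thesis by simp
  qed
  \<comment> \<open>The order is reversed for Zorn's lemma, so the bound of a nonempty chain is its
    pointwise infimum.\<close>
  have "\<exists>m\<in>A. \<forall>q\<in>A. q \<le> m \<longrightarrow> q = m"
  proof (rule predicate_Zorn)
    show "partial_order_on A (relation_of (\<lambda>m q. q \<le> m) A)"
      unfolding relation_of_def partial_order_on_def preorder_on_def
      by (auto simp: refl_on_def trans_def antisym_def)
  next
    fix C
    assume C: "C \<in> Chains (relation_of (\<lambda>m q. q \<le> m) A)"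
    then have CA: "C \<subseteq> A" and lin: "\<And>q r. q \<in> C \<Longrightarrow> r \<in> C \<Longrightarrow> q \<le> r \<or> r \<le> q"
      by (auto simp: Chains_def relation_of_def)
    show "\<exists>u\<in>A. \<forall>a\<in>C. u \<le> a"
    proof (cases "C = {}")
      case True
      then show ?thesis using p by (auto simp: A_def)
    next
      case False
      define u where "u = (\<lambda>x. INF q\<in>C. q x)"
      have u_le: "u x \<le> q x" if "q \<in> C" for q x
        unfolding u_def using that lower CA
        by (intro cINF_lower bdd_belowI2[where m = "- p (- x)"]) auto
      have u_ge: "c \<le> u x" if "\<And>q. q \<in> C \<Longrightarrow> c \<le> q x" for c x
        unfolding u_def using False that by (intro cINF_greatest) auto
      have sub: "sublinear q" if "q \<in> C" for q using that CA by (auto simp: A_def)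
      have "sublinear u"
      proof (rule sublinearI)
        fix x y
        have "u (x + y) - q x \<le> r y" if "q \<in> C" "r \<in> C" for q r
        proof -
          \<comment> \<open>In a chain the smaller of \<open>q\<close> and \<open>r\<close> can play
            both roles; this makes the infimum subadditive.\<close>
          obtain s where s: "s \<in> C" "s \<le> q" "s \<le> r" using lin \<open>q \<in> C\<close> \<open>r \<in> C\<close> by blast
          have "u (x + y) \<le> s (x + y)" by (rule u_le[OF s(1)])
          also have "\<dots> \<le> s x + s y" by (rule sublinear_add[OF sub[OF s(1)]])
          also have "\<dots> \<le> q x + r y" using s by (intro add_mono) (auto simp: le_fun_def)
          finally show ?thesis by simp
        qed
        then have "u (x + y) - q x \<le> u y" if "q \<in> C" for q using that by (intro u_ge) auto
        then have "u (x + y) - u y \<le> u x" by (intro u_ge) (simp add: algebra_simps)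
        then show "u (x + y) \<le> u x + u y" by simp
      next
        fix t :: real and x
        assume t: "0 < t"
        have "u (t *\<^sub>R x) / t \<le> u x"
        proof (rule u_ge)
          fix q assume q: "q \<in> C"
          show "u (t *\<^sub>R x) / t \<le> q x"
            using u_le[OF q, of "t *\<^sub>R x"] sublinear_scaleR[OF sub[OF q], of t x] t
            by (simp add: field_simps)
        qed
        then show "u (t *\<^sub>R x) \<le> t * u x" using t by (simp add: field_simps)
      next
        show "u 0 = 0" unfolding u_def using False by (simp add: sublinear_zero sub)
      qed
      moreover obtain q where "q \<in> C" using False by blast
      then have "u \<le> q" "q \<le> p" using u_le CA by (auto simp: A_def le_fun_def)
      then have "u \<le> p" by (rule order_trans)
      ultimately show ?thesis using u_le by (auto simp: A_def le_fun_def)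
    qed
  qed
  then obtain m where m: "m \<in> A" and min: "\<And>q. q \<in> A \<Longrightarrow> q \<le> m \<Longrightarrow> q = m" by blast
  have sub: "sublinear m" using m by (simp add: A_def)
  have neg: "m (- x) = - m x" for x
  proof -
    have "slide m x \<le> m" by (simp add: le_fun_def slide_le_self sub)
    moreover have "slide m x \<in> A"
      using m \<open>slide m x \<le> m\<close> by (auto simp: A_def sublinear_slide)
    ultimately have "m (- x) \<le> - m x" using min[of "slide m x"] slide_minus[OF sub, of x] by simp
    moreover have "- m x \<le> m (- x)"
      using sublinear_add[OF sub, of x "- x"] sublinear_zero[OF sub] by simp
    ultimately show ?thesis by simp
  qed
  have "linear m"
  proof (rule linearI)
    fix x y
    have "m (- x + - y) \<le> m (- x) + m (- y)" by (rule sublinear_add[OF sub])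
    moreover have "m (- x + - y) = - m (x + y)" using neg[of "x + y"] by simp
    ultimately have "m x + m y \<le> m (x + y)" by (simp add: neg)
    with sublinear_add[OF sub, of x y] show "m (x + y) = m x + m y" by simp
  next
    fix r x
    show "m (r *\<^sub>R x) = r *\<^sub>R m x"
    proof (cases "0 \<le> r")
      case True
      then show ?thesis using sublinear_scaleR[OF sub] by simp
    next
      case False
      then have "m ((- r) *\<^sub>R x) = - r * m x" using sublinear_scaleR[OF sub, of "- r" x] by simp
      then show ?thesis using neg[of "r *\<^sub>R x"] by simp
    qed
  qed
  then show ?thesis using m by (auto simp: A_def le_fun_def)
qed

text \<open>Domination by \<open>slide norm x\<close> instead of \<open>norm\<close> also forces
  \<open>f (- x) \<le> - norm x\<close>, which gives \<open>f x = norm x\<close>.\<close>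

lemma norming_functional:
  fixes x :: "'a::real_normed_vector"
  shows "\<exists>f :: 'a \<Rightarrow>\<^sub>L real. norm f \<le> 1 \<and> blinfun_apply f x = norm x"
proof -
  have sub: "sublinear (norm :: 'a \<Rightarrow> real)"
    by (simp add: sublinear_def norm_triangle_ineq)
  obtain f where f: "linear f" "\<And>y. f y \<le> slide norm x y"
    using linear_below_sublinear[OF sublinear_slide[OF sub]] by blast
  have le: "f y \<le> norm y" for y using f(2) slide_le_self[OF sub] order_trans by blast
  have minus: "f (- y) = - f y" for y using f(1) by (rule linear_neg)
  have abs: "\<bar>f y\<bar> \<le> norm y" for y using le[of y] le[of "- y"] minus[of y] by simp
  have bl: "bounded_linear f"
    using f(1) abs by (intro bounded_linear_intro[where K = 1]) (auto simp: linear_iff)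
  have "f x = norm x"
    using f(2)[of "- x"] slide_minus[OF sub, of x] minus[of x] le[of x] by simp
  moreover have "norm (Blinfun f) \<le> 1"
    using abs by (intro norm_blinfun_bound) (auto simp: bounded_linear_Blinfun_apply bl)
  ultimately show ?thesis
    by (intro exI[of _ "Blinfun f"]) (simp add: bounded_linear_Blinfun_apply bl)
qed

section \<open>Oscillating sequences of functionals\<close>

text \<open>The combinations may overlap; only the tail condition matters. It lets every eventual
  bound on \<open>f\<close> that convex combinations respect pass to \<open>s\<close>, and it makes
  the relation transitive.\<close>

definition convex_block :: "(nat \<Rightarrow> 'a::real_vector) \<Rightarrow> (nat \<Rightarrow> 'a) \<Rightarrow> bool" where
  "convex_block f s \<longleftrightarrow> (\<forall>j. s j \<in> convex hull (f ` {j..}))"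

lemma convex_block_refl: "convex_block f f"
  by (auto simp: convex_block_def intro: hull_inc)

lemma convex_block_hull:
  assumes "convex_block f s"
  shows "convex hull (s ` {j..}) \<subseteq> convex hull (f ` {j..})"
proof (rule hull_minimal)
  show "s ` {j..} \<subseteq> convex hull (f ` {j..})"
  proof
    fix v assume "v \<in> s ` {j..}"
    then obtain i where "j \<le> i" "v = s i" by auto
    moreover have "s i \<in> convex hull (f ` {i..})" using assms by (simp add: convex_block_def)
    moreover have "convex hull (f ` {i..}) \<subseteq> convex hull (f ` {j..})"
      using \<open>j \<le> i\<close> by (intro hull_mono) auto
    ultimately show "v \<in> convex hull (f ` {j..})" by auto
  qed
qed (rule convex_convex_hull)

lemma convex_block_trans: "convex_block f s \<Longrightarrow> convex_block s t \<Longrightarrow> convex_block f t"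
  using convex_block_hull unfolding convex_block_def by blast

lemma convex_block_mean:
  assumes s: "convex_block f s" and jl: "\<And>m. m \<le> j m" "\<And>m. m \<le> l m"
  shows "convex_block f (\<lambda>m. (1 / 2) *\<^sub>R (s (j m) + s (l m)))"
  unfolding convex_block_def
proof
  fix m
  have "s (j m) \<in> convex hull (f ` {m..})" "s (l m) \<in> convex hull (f ` {m..})"
    using convex_block_hull[OF s, of m] jl[of m] hull_inc[of _ "s ` {m..}"] by (auto simp: subset_iff)
  from convexD[OF convex_convex_hull this, of "1/2" "1/2"]
  show "(1 / 2) *\<^sub>R (s (j m) + s (l m)) \<in> convex hull (f ` {m..})"
    by (simp add: scaleR_add_right)
qed

lemma linear_le_on_hull:
  assumes "linear h" "\<And>v. v \<in> S \<Longrightarrow> h v \<le> (c::real)" "v \<in> convex hull S"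
  shows "h v \<le> c"
proof -
  have "convex (h -` {..c})" using assms(1) by (intro convex_linear_vimage) auto
  then have "convex hull S \<subseteq> h -` {..c}" using assms(2) by (intro hull_minimal) auto
  then show ?thesis using assms(3) by auto
qed

lemma linear_blinfun_apply_at: "linear (\<lambda>u. blinfun_apply u x)"
  by (simp add: linear_iff plus_blinfun.rep_eq scaleR_blinfun.rep_eq)

lemma convex_block_norm:
  fixes f :: "nat \<Rightarrow> 'a::real_normed_vector"
  assumes "convex_block f s" "\<And>n. norm (f n) \<le> 1"
  shows "norm (s n) \<le> 1"
proof -
  have "convex hull (f ` {n..}) \<subseteq> cball 0 1" using assms(2) by (intro hull_minimal) auto
  then show ?thesis using assms(1) by (auto simp: convex_block_def)
qed

text \<open>A tail of \<open>h (f n)\<close> lies in a small interval, and the preimage of a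
  half-line under a linear map is convex. The two ends are treated through \<open>h\<close> and its
  negative.\<close>

lemma convex_block_tendsto:
  assumes s: "convex_block f s" and h: "linear h" and lim: "(\<lambda>n. h (f n)) \<longlonglongrightarrow> (l::real)"
  shows "(\<lambda>n. h (s n)) \<longlonglongrightarrow> l"
proof (rule LIMSEQ_I)
  fix e :: real assume "e > 0"
  then obtain N where "\<forall>n\<ge>N. norm (h (f n) - l) < e / 2" using LIMSEQ_D[OF lim, of "e / 2"] by auto
  then have N: "h (f n) \<le> l + e / 2" "- h (f n) \<le> - l + e / 2" if "N \<le> n" for n
    using that by (auto simp: abs_if split: if_splits dest!: spec[of _ n])
  have "norm (h (s n) - l) < e" if "N \<le> n" for n
  proof -
    have mem: "s n \<in> convex hull (f ` {n..})" using s by (simp add: convex_block_def)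
    have "h (s n) \<le> l + e / 2"
      by (rule linear_le_on_hull[OF h _ mem]) (use N that in auto)
    moreover have "- h (s n) \<le> - l + e / 2"
      by (rule linear_le_on_hull[OF linear_compose_neg[OF h] _ mem]) (use N that in auto)
    ultimately show ?thesis using \<open>e > 0\<close> by (simp add: abs_if)
  qed
  then show "\<exists>N. \<forall>n\<ge>N. norm (h (s n) - l) < e" by blast
qed

section \<open>Pointwise oscillation, cluster points and Rademacher averages\<close>

definition osc_le :: "real \<Rightarrow> (nat \<Rightarrow> 'a::real_normed_vector \<Rightarrow>\<^sub>L real) \<Rightarrow> bool" where
  "osc_le e f \<longleftrightarrow> (\<forall>x. norm x \<le> 1 \<longrightarrow>
     (\<exists>N. \<forall>j\<ge>N. \<forall>l\<ge>N. blinfun_apply (f j) x - blinfun_apply (f l) x \<le> e))"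

lemma hull_diff_le:
  fixes f :: "nat \<Rightarrow> 'a::real_normed_vector \<Rightarrow>\<^sub>L real"
  assumes le: "\<And>j l. N \<le> j \<Longrightarrow> N \<le> l \<Longrightarrow> blinfun_apply (f j) x - blinfun_apply (f l) x \<le> e"
    and u: "u \<in> convex hull (f ` {N..})" and v: "v \<in> convex hull (f ` {N..})"
  shows "blinfun_apply u x - blinfun_apply v x \<le> e"
proof -
  have "blinfun_apply u x \<le> e + blinfun_apply (f l) x" if "N \<le> l" for l
    by (rule linear_le_on_hull[OF linear_blinfun_apply_at _ u]) (use le that in force)
  then have "- blinfun_apply v x \<le> e - blinfun_apply u x"
    by (intro linear_le_on_hull[OF linear_compose_neg[OF linear_blinfun_apply_at] _ v]) force
  then show ?thesis by simp
qed

text \<open>A Banach--Alaoglu argument: the values at all pairs \<open>(i, x)\<close> lie in a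
  product of compact intervals, so by Tychonoff they have a cluster point. Linearity, Bessel's
  inequality and the lower bounds are closed conditions on finitely many coordinates and survive. A
  convergent subsequence need not exist, as the space may be nonseparable.\<close>

lemma bessel_cluster:
  fixes G :: "nat \<Rightarrow> nat \<Rightarrow> 'a::real_normed_vector \<Rightarrow>\<^sub>L real"
  assumes bessel: "\<And>k n x. (\<Sum>i<n. (blinfun_apply (G k i) x)\<^sup>2) \<le> (norm x)\<^sup>2"
    and lower: "\<And>i. eventually (\<lambda>k. c \<le> blinfun_apply (G k i) (p i)) sequentially"
  shows "\<exists>g :: nat \<Rightarrow> 'a \<Rightarrow>\<^sub>L real. (\<forall>n x. (\<Sum>i<n. (blinfun_apply (g i) x)\<^sup>2) \<le> (norm x)\<^sup>2) \<and>
           (\<forall>i. c \<le> blinfun_apply (g i) (p i))"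
proof -
  define F where "F k = (\<lambda>z. blinfun_apply (G k (fst z)) (snd z))" for k
  define K where "K = (Pi\<^sub>E UNIV (\<lambda>z::nat \<times> 'a. {- norm (snd z)..norm (snd z)}))"
  have abs: "\<bar>blinfun_apply (G k i) x\<bar> \<le> norm x" for k i x
  proof -
    have "(blinfun_apply (G k i) x)\<^sup>2 \<le> (\<Sum>i<Suc i. (blinfun_apply (G k i) x)\<^sup>2)"
      by (intro member_le_sum) auto
    also note bessel
    finally show ?thesis by (simp add: abs_le_square_iff[symmetric])
  qed
  have "compact K"
    unfolding compactin_euclidean_iff[symmetric] K_def euclidean_product_topology[symmetric]
      compactin_PiE
    by (simp add: compactin_euclidean_iff)
  moreover have "filtermap F sequentially \<noteq> bot" by (simp add: filtermap_bot_iff)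
  moreover have "eventually (\<lambda>H. H \<in> K) (filtermap F sequentially)"
  proof -
    have "- norm x \<le> blinfun_apply (G k i) x \<and> blinfun_apply (G k i) x \<le> norm x" for k i x
      using abs[of k i x] by linarith
    then have "F k \<in> K" for k by (simp add: F_def K_def PiE_iff)
    then show ?thesis by (simp add: eventually_filtermap)
  qed
  ultimately obtain H where H: "H \<in> K" "inf (nhds H) (filtermap F sequentially) \<noteq> bot"
    unfolding compact_filter by blast
  \<comment> \<open>A cluster point lies in every closed set that eventually contains the sequence;
    this is how each property is transferred to \<open>H\<close>.\<close>
  have closed: "H \<in> S" if "closed S" "eventually (\<lambda>k. F k \<in> S) sequentially" for S
  proof (rule ccontr)
    assume "H \<notin> S"
    then have "eventually (\<lambda>H. H \<in> - S) (nhds H)"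
      using that(1) by (intro eventually_nhds_in_open) auto
    moreover have "eventually (\<lambda>H. H \<in> S) (filtermap F sequentially)"
      using that(2) by (simp add: eventually_filtermap)
    ultimately have "eventually (\<lambda>H. False) (inf (nhds H) (filtermap F sequentially))"
      unfolding eventually_inf by fastforce
    then show False using H(2) by (simp add: trivial_limit_def)
  qed
  have coord [continuous_intros]: "continuous_on UNIV (\<lambda>H::nat \<times> 'a \<Rightarrow> real. H z)" for z
    by (rule continuous_on_product_coordinates)
  have add: "H (i, x + y) = H (i, x) + H (i, y)" for i x y
  proof -
    have "H \<in> {H. H (i, x + y) = H (i, x) + H (i, y)}"
      by (rule closed, intro closed_Collect_eq continuous_intros) (simp add: F_def blinfun.add_right)
    then show ?thesis by simp
  qed
  have scale: "H (i, r *\<^sub>R x) = r * H (i, x)" for i x r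
  proof -
    have "H \<in> {H. H (i, r *\<^sub>R x) = r * H (i, x)}"
      by (rule closed, intro closed_Collect_eq continuous_intros) (simp add: F_def blinfun.scaleR_right)
    then show ?thesis by simp
  qed
  have "\<bar>H (i, x)\<bar> \<le> norm x" for i x
    using PiE_mem[OF H(1)[unfolded K_def], of "(i, x)"] by (simp add: abs_le_iff)
  then have bl: "bounded_linear (\<lambda>x. H (i, x))" for i
    by (intro bounded_linear_intro[where K = 1]) (simp_all add: add scale)
  have "(\<Sum>i<n. (H (i, x))\<^sup>2) \<le> (norm x)\<^sup>2" for n x
  proof -
    have "H \<in> {H. (\<Sum>i<n. (H (i, x))\<^sup>2) \<le> (norm x)\<^sup>2}"
      by (rule closed, intro closed_Collect_le continuous_intros) (simp add: F_def bessel)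
    then show ?thesis by simp
  qed
  moreover have "c \<le> H (i, p i)" for i
  proof -
    have "H \<in> {H. c \<le> H (i, p i)}"
      by (rule closed, intro closed_Collect_le continuous_intros) (simp add: F_def lower)
    then show ?thesis by simp
  qed
  ultimately show ?thesis
    by (intro exI[of _ "\<lambda>i. Blinfun (\<lambda>x. H (i, x))"]) (simp add: bounded_linear_Blinfun_apply bl)
qed

text \<open>The parallelogram law turns the last two terms into
  \<open>(u\<^sup>2 + v\<^sup>2) / 2\<close>, and convexity of the square handles the sum; the left
  side is thus at most the mean of the two assumed left sides.\<close>

lemma mean_sum_squares_le:
  fixes a b :: "nat \<Rightarrow> real"
  assumes "(\<Sum>i<k. (a i)\<^sup>2) + u\<^sup>2 \<le> c" "(\<Sum>i<k. (b i)\<^sup>2) + v\<^sup>2 \<le> c"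
  shows "(\<Sum>i<k. ((a i + b i) / 2)\<^sup>2) + ((u - v) / 2)\<^sup>2 + ((u + v) / 2)\<^sup>2 \<le> c"
proof -
  have "(\<Sum>i<k. ((a i + b i) / 2)\<^sup>2) \<le> (\<Sum>i<k. ((a i)\<^sup>2 + (b i)\<^sup>2) / 2)"
  proof (rule sum_mono)
    fix i
    have "0 \<le> (a i - b i)\<^sup>2" by simp
    then show "((a i + b i) / 2)\<^sup>2 \<le> ((a i)\<^sup>2 + (b i)\<^sup>2) / 2"
      by (simp add: power2_eq_square field_simps)
  qed
  also have "\<dots> = ((\<Sum>i<k. (a i)\<^sup>2) + (\<Sum>i<k. (b i)\<^sup>2)) / 2"
    by (simp add: sum_divide_distrib[symmetric] sum.distrib)
  finally show ?thesis using assms by (simp add: power2_eq_square field_simps)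
qed

text \<open>A Rademacher construction. From two far members \<open>s (j m)\<close>, \<open>s (l m)\<close> of the current block sequence
  one keeps half the difference as the \<open>m\<close>-th candidate for the next functional, and half the sum as
  the \<open>m\<close>-th member of the next block sequence; the earlier candidates are averaged likewise. By the
  parallelogram law (\<open>mean_sum_squares_le\<close>) this preserves the bound on the sum of squares, and
  averaging preserves the lower bounds at the points chosen before.\<close>

lemma null_sequence_of_oscillation:
  fixes f :: "nat \<Rightarrow> 'a::real_normed_vector \<Rightarrow>\<^sub>L real"
  assumes bound: "\<And>n. norm (f n) \<le> 1" and e: "e > 0"
    and osc: "\<And>s. convex_block f s \<Longrightarrow> \<not> osc_le e s"
  shows "\<exists>g :: nat \<Rightarrow> 'a \<Rightarrow>\<^sub>L real. (\<forall>n. norm (g n) \<le> 1 \<and> e / 2 \<le> norm (g n)) \<and>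
           (\<forall>x. (\<lambda>n. blinfun_apply (g n) x) \<longlonglongrightarrow> 0)"
proof -
  \<comment> \<open>The state after \<open>k\<close> stages. The bounds are kept for every index
    \<open>j\<close> at once, because the next stage may pick arbitrarily late members.\<close>
  define inv where "inv k s g p \<longleftrightarrow> convex_block f s \<and>
      (\<forall>j x. (\<Sum>i<k. (blinfun_apply (g i j) x)\<^sup>2) + (blinfun_apply (s j) x)\<^sup>2 \<le> (norm x)\<^sup>2) \<and>
      (\<forall>i<k. norm (p i) \<le> 1 \<and> (\<forall>j. e / 2 \<le> blinfun_apply (g i j) (p i)))"
    for k s and g :: "nat \<Rightarrow> nat \<Rightarrow> 'a \<Rightarrow>\<^sub>L real" and p :: "nat \<Rightarrow> 'a"
  have "(blinfun_apply (f j) x)\<^sup>2 \<le> (norm x)\<^sup>2" for j x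
  proof -
    have "\<bar>blinfun_apply (f j) x\<bar> \<le> norm (f j) * norm x" using norm_blinfun[of "f j" x] by simp
    also have "\<dots> \<le> norm x" using bound[of j] by (simp add: mult_left_le_one_le)
    finally show ?thesis by (simp add: abs_le_square_iff[symmetric])
  qed
  then have base: "inv 0 f (\<lambda>_ _. 0) (\<lambda>_. 0)"
    by (simp add: inv_def convex_block_refl)
  have step: "\<exists>s' g' p'. inv (Suc k) s' g' p' \<and> (\<forall>i<k. p' i = p i)" if i: "inv k s g p" for k s g p
  proof -
    have "\<not> osc_le e s" using i osc by (simp add: inv_def)
    \<comment> \<open>Failure of \<open>osc_le\<close> provides one point for all thresholds, so the
      same \<open>x\<close> serves every index \<open>m\<close> of the new candidate.\<close>
    then obtain x where x: "norm x \<le> 1"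
      and "\<forall>N. \<exists>j l. N \<le> j \<and> N \<le> l \<and> e < blinfun_apply (s j) x - blinfun_apply (s l) x"
      by (auto simp: osc_le_def not_le)
    then obtain j l where jl: "\<And>m. m \<le> j m" "\<And>m. m \<le> l m"
      and ge: "\<And>m. e < blinfun_apply (s (j m)) x - blinfun_apply (s (l m)) x" by metis
    define s' where "s' = (\<lambda>m. (1 / 2) *\<^sub>R (s (j m) + s (l m)))"
    define g' where "g' = (\<lambda>i m. if i < k then (1 / 2) *\<^sub>R (g i (j m) + g i (l m))
                                 else (1 / 2) *\<^sub>R (s (j m) - s (l m)))"
    have "convex_block f s'"
      unfolding s'_def using i jl by (intro convex_block_mean) (auto simp: inv_def)
    moreover have "(\<Sum>i<Suc k. (blinfun_apply (g' i m) y)\<^sup>2) + (blinfun_apply (s' m) y)\<^sup>2 \<le> (norm y)\<^sup>2" for m y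
      using mean_sum_squares_le[of "\<lambda>i. blinfun_apply (g i (j m)) y" k "blinfun_apply (s (j m)) y"
          "(norm y)\<^sup>2" "\<lambda>i. blinfun_apply (g i (l m)) y" "blinfun_apply (s (l m)) y"] i
      by (simp add: inv_def g'_def s'_def blinfun.scaleR_left blinfun.add_left blinfun.diff_left)
    moreover have "norm ((p(k := x)) i) \<le> 1 \<and> (\<forall>m. e / 2 \<le> blinfun_apply (g' i m) ((p(k := x)) i))"
      if "i < Suc k" for i
    proof (cases "i = k")
      case True
      then show ?thesis using x ge
        by (auto simp: g'_def blinfun.scaleR_left blinfun.diff_left intro: less_imp_le)
    next
      case False
      then have ik: "i < k" using that by simp
      have le: "e / 2 \<le> blinfun_apply (g i m) (p i)" for m using i ik by (auto simp: inv_def)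
      have "e / 2 \<le> (blinfun_apply (g i (j m)) (p i) + blinfun_apply (g i (l m)) (p i)) / 2" for m
        using le[of "j m"] le[of "l m"] by simp
      then show ?thesis using i ik by (auto simp: inv_def g'_def blinfun.scaleR_left blinfun.add_left)
    qed
    ultimately have "inv (Suc k) s' g' (p(k := x))" unfolding inv_def by blast
    then show ?thesis by (intro exI[of _ s'] exI[of _ g'] exI[of _ "p(k := x)"]) auto
  qed
  define Inv where "Inv k z \<longleftrightarrow> inv k (fst z) (fst (snd z)) (snd (snd z))"
    for k and z :: "(nat \<Rightarrow> 'a \<Rightarrow>\<^sub>L real) \<times> (nat \<Rightarrow> nat \<Rightarrow> 'a \<Rightarrow>\<^sub>L real) \<times> (nat \<Rightarrow> 'a)"
  \<comment> \<open>Later stages average the functionals again, but they never move a point already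
    chosen.\<close>
  have "\<exists>S. \<forall>k. Inv k (S k) \<and> (\<forall>i<k. snd (snd (S (Suc k))) i = snd (snd (S k)) i)"
  proof (rule dependent_nat_choice)
    have "Inv 0 (f, \<lambda>_ _. 0, \<lambda>_. 0)"
      using base by (simp add: Inv_def)
    then show "\<exists>z. Inv 0 z" by blast
  next
    fix z k
    assume "Inv k z"
    then obtain s' g' p' where "inv (Suc k) s' g' p'" "\<forall>i<k. p' i = snd (snd z) i"
      using step unfolding Inv_def by blast
    then have "Inv (Suc k) (s', g', p') \<and> (\<forall>i<k. snd (snd (s', g', p')) i = snd (snd z) i)"
      by (simp add: Inv_def)
    then show "\<exists>z'. Inv (Suc k) z' \<and> (\<forall>i<k. snd (snd z') i = snd (snd z) i)" by (rule exI)
  qed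
  then obtain S where S: "\<forall>k. Inv k (S k) \<and> (\<forall>i<k. snd (snd (S (Suc k))) i = snd (snd (S k)) i)" ..
  then have coh: "snd (snd (S (Suc k))) i = snd (snd (S k)) i" if "i < k" for k i
    using that by blast
  \<comment> \<open>Stage \<open>Suc i\<close> is the first one that fixes the point with index
    \<open>i\<close>.\<close>
  define P where "P i = snd (snd (S (Suc i))) i" for i
  have P: "snd (snd (S k)) i = P i" if "i < k" for k i
    using that
  proof (induction k)
    case (Suc k)
    then show ?case using coh[of i k] by (cases "i = k") (auto simp: P_def)
  qed simp
  \<comment> \<open>One member of each candidate sequence suffices, here index \<open>0\<close>;
    padding by zero makes Bessel's inequality hold for any number of terms.\<close>
  define G where "G k i = (if i < k then fst (snd (S k)) i 0 else 0)" for k i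
  have inv: "inv k (fst (S k)) (fst (snd (S k))) (snd (snd (S k)))" for k
    using S by (simp add: Inv_def)
  have bessel: "(\<Sum>i<n. (blinfun_apply (G k i) x)\<^sup>2) \<le> (norm x)\<^sup>2" for k n x
  proof -
    have "(\<Sum>i<n. (blinfun_apply (G k i) x)\<^sup>2) \<le> (\<Sum>i<max n k. (blinfun_apply (G k i) x)\<^sup>2)"
      by (intro sum_mono2) auto
    also have "\<dots> = (\<Sum>i<k. (blinfun_apply (G k i) x)\<^sup>2)"
      by (rule sum.mono_neutral_right) (auto simp: G_def)
    also have "\<dots> = (\<Sum>i<k. (blinfun_apply (fst (snd (S k)) i 0) x)\<^sup>2)"
      by (simp add: G_def)
    also have "\<dots> \<le> \<dots> + (blinfun_apply (fst (S k) 0) x)\<^sup>2" by simp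
    also have "\<dots> \<le> (norm x)\<^sup>2" using inv[of k] unfolding inv_def by blast
    finally show ?thesis .
  qed
  have lower: "e / 2 \<le> blinfun_apply (G k i) (P i)" "norm (P i) \<le> 1" if "i < k" for k i
    using inv[of k] that P[OF that] by (auto simp: inv_def G_def)
  have "eventually (\<lambda>k. e / 2 \<le> blinfun_apply (G k i) (P i)) sequentially" for i
    by (rule eventually_mono[OF eventually_gt_at_top[of i]]) (rule lower(1))
  from bessel_cluster[OF bessel this] obtain g :: "nat \<Rightarrow> 'a \<Rightarrow>\<^sub>L real" where
    g: "\<And>n x. (\<Sum>i<n. (blinfun_apply (g i) x)\<^sup>2) \<le> (norm x)\<^sup>2" and gP: "\<And>i. e / 2 \<le> blinfun_apply (g i) (P i)"
    by blast
  have abs: "\<bar>blinfun_apply (g i) x\<bar> \<le> norm x" for i x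
  proof -
    have "(blinfun_apply (g i) x)\<^sup>2 \<le> (\<Sum>i<Suc i. (blinfun_apply (g i) x)\<^sup>2)"
      by (intro member_le_sum) auto
    also note g
    finally show ?thesis by (simp add: abs_le_square_iff[symmetric])
  qed
  have "norm (g i) \<le> 1" for i
    using abs by (intro norm_blinfun_bound) auto
  moreover have "e / 2 \<le> norm (g i)" for i
  proof -
    have "e / 2 \<le> norm (blinfun_apply (g i) (P i))" using gP[of i] by simp
    also have "\<dots> \<le> norm (g i) * norm (P i)" by (rule norm_blinfun)
    also have "\<dots> \<le> norm (g i)" using lower(2)[of i "Suc i"] by (simp add: mult_left_le)
    finally show ?thesis .
  qed
  moreover have "(\<lambda>n. blinfun_apply (g n) x) \<longlonglongrightarrow> 0" for x
  proof -
    \<comment> \<open>Bessel's inequality bounds the partial sums, so the squares are summable and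
      the values tend to zero.\<close>
    have "summable (\<lambda>n. (blinfun_apply (g n) x)\<^sup>2)"
      using g by (intro summableI_nonneg_bounded[where x = "(norm x)\<^sup>2"]) auto
    then have "(\<lambda>n. (blinfun_apply (g n) x)\<^sup>2) \<longlonglongrightarrow> 0" by (rule summable_LIMSEQ_zero)
    from tendsto_real_sqrt[OF this] show ?thesis by (simp add: tendsto_rabs_zero_iff)
  qed
  ultimately show ?thesis by blast
qed

section \<open>The Josefson--Nissenzweig theorem\<close>

text \<open>The uniform lower bound \<open>c\<close> stands for the usual normalisation to the unit
  sphere.\<close>

definition weak_star_null :: "real \<Rightarrow> (nat \<Rightarrow> 'a::real_normed_vector \<Rightarrow>\<^sub>L real) \<Rightarrow> bool" where
  "weak_star_null c g \<longleftrightarrow> 0 < c \<and> (\<forall>n. norm (g n) \<le> 1 \<and> c \<le> norm (g n)) \<and>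
     (\<forall>x. (\<lambda>n. blinfun_apply (g n) x) \<longlonglongrightarrow> 0)"

text \<open>Pairs of far members that stay \<open>e\<close> apart have differences that vanish
  pointwise, both members tending to the same limit. The factor \<open>1 / 2\<close> keeps the norms
  at most \<open>1\<close>.\<close>

lemma weak_star_null_differences:
  fixes f :: "nat \<Rightarrow> 'a::real_normed_vector \<Rightarrow>\<^sub>L real"
  assumes bound: "\<And>n. norm (f n) \<le> 1"
    and conv: "\<And>x. convergent (\<lambda>n. blinfun_apply (f n) x)"
    and "\<not> Cauchy f"
  shows "\<exists>c g :: nat \<Rightarrow> 'a \<Rightarrow>\<^sub>L real. weak_star_null c g"
proof -
  obtain e where e: "e > 0" "\<And>N. \<exists>j\<ge>N. \<exists>l\<ge>N. e \<le> dist (f j) (f l)"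
    using assms(3) unfolding Cauchy_def by (auto simp: not_less)
  then obtain j l where jl: "\<And>m. m \<le> j m" "\<And>m. m \<le> l m" "\<And>m. e \<le> dist (f (j m)) (f (l m))"
    by metis
  define g where "g m = (1 / 2) *\<^sub>R (f (j m) - f (l m))" for m
  have "norm (g m) \<le> 1" for m
    using norm_triangle_ineq4[of "f (j m)" "f (l m)"] bound[of "j m"] bound[of "l m"]
    by (simp add: g_def)
  moreover have "e / 2 \<le> norm (g m)" for m
    using jl(3)[of m] by (simp add: g_def dist_norm)
  moreover have "(\<lambda>m. blinfun_apply (g m) x) \<longlonglongrightarrow> 0" for x
  proof -
    obtain L where L: "(\<lambda>n. blinfun_apply (f n) x) \<longlonglongrightarrow> L"
      using conv[of x] by (auto simp: convergent_def)
    have "filterlim j at_top sequentially" "filterlim l at_top sequentially"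
      using jl by (auto intro!: filterlim_at_top_mono[OF filterlim_ident] always_eventually)
    then have "(\<lambda>m. (blinfun_apply (f (j m)) x - blinfun_apply (f (l m)) x) / 2) \<longlonglongrightarrow> (L - L) / 2"
      using L by (intro tendsto_intros filterlim_compose[OF L]) auto
    then show ?thesis by (simp add: g_def blinfun.scaleR_left blinfun.diff_left)
  qed
  ultimately have "weak_star_null (e / 2) g" using e(1) by (simp add: weak_star_null_def)
  then show ?thesis by blast
qed

text \<open>Without weak-star null sequences the oscillation of convex blocks can be made as small
  as desired. A diagonal of successive blocks then converges pointwise, and it is norm Cauchy
  because otherwise its differences would be weak-star null.\<close>

lemma convergent_convex_block:
  fixes f :: "nat \<Rightarrow> 'a::real_normed_vector \<Rightarrow>\<^sub>L real"
  assumes bound: "\<And>n. norm (f n) \<le> 1"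
    and none: "\<And>c (g :: nat \<Rightarrow> 'a \<Rightarrow>\<^sub>L real). \<not> weak_star_null c g"
  shows "\<exists>s. convex_block f s \<and> convergent s"
proof -
  have small: "\<exists>t. convex_block s t \<and> osc_le e t" if s: "convex_block f s" and e: "e > 0" for s e
  proof (rule ccontr)
    assume "\<not> ?thesis"
    then have "\<exists>g :: nat \<Rightarrow> 'a \<Rightarrow>\<^sub>L real. (\<forall>n. norm (g n) \<le> 1 \<and> e / 2 \<le> norm (g n)) \<and>
           (\<forall>x. (\<lambda>n. blinfun_apply (g n) x) \<longlonglongrightarrow> 0)"
      using e convex_block_norm[OF s bound] by (intro null_sequence_of_oscillation) auto
    then have "\<exists>g :: nat \<Rightarrow> 'a \<Rightarrow>\<^sub>L real. weak_star_null (e / 2) g"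
      using e by (simp add: weak_star_null_def)
    then show False using none by blast
  qed
  have "\<exists>S. \<forall>k. convex_block f (S k) \<and>
          (convex_block (S k) (S (Suc k)) \<and> osc_le (1 / real (Suc k)) (S (Suc k)))"
  proof (rule dependent_nat_choice)
    show "\<exists>s. convex_block f s" using convex_block_refl by blast
  next
    fix s :: "nat \<Rightarrow> 'a \<Rightarrow>\<^sub>L real" and k :: nat
    assume s: "convex_block f s"
    obtain t where t: "convex_block s t" "osc_le (1 / real (Suc k)) t"
      using small[OF s, of "1 / real (Suc k)"] by auto
    then show "\<exists>t. convex_block f t \<and> convex_block s t \<and> osc_le (1 / real (Suc k)) t"
      using convex_block_trans[OF s t(1)] by blast
  qed
  then obtain S where S: "\<And>k. convex_block f (S k)" "\<And>k. convex_block (S k) (S (Suc k))"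
    "\<And>k. osc_le (1 / real (Suc k)) (S (Suc k))"
    by blast
  \<comment> \<open>The diagonal: from index \<open>k\<close> on, \<open>d\<close> lies in the hulls
    of the tails of \<open>S k\<close>, so it inherits the oscillation bound of every stage.\<close>
  define d where "d k = S k k" for k
  have mono: "convex_block (S k) (S (k + m))" for k m
    by (induction m) (auto intro: convex_block_refl convex_block_trans S(2))
  have d_mem: "d j \<in> convex hull (S k ` {N..})" if "k \<le> j" "N \<le> j" for j k N
  proof -
    have "d j \<in> convex hull (S k ` {j..})"
      using mono[of k "j - k"] that by (simp add: convex_block_def d_def)
    moreover have "convex hull (S k ` {j..}) \<subseteq> convex hull (S k ` {N..})"
      using that by (intro hull_mono) auto
    ultimately show ?thesis by blast
  qed
  have d: "convex_block f d"
    using d_mem S(1) convex_block_hull unfolding convex_block_def by (metis d_def)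
  have ball: "Cauchy (\<lambda>n. blinfun_apply (d n) x)" if x: "norm x \<le> 1" for x
  proof (rule metric_CauchyI)
    fix e :: real assume "e > 0"
    then obtain k where k: "1 / real (Suc k) < e"
      using nat_approx_posE by blast
    obtain N where N: "\<And>j l. N \<le> j \<Longrightarrow> N \<le> l \<Longrightarrow>
        blinfun_apply (S (Suc k) j) x - blinfun_apply (S (Suc k) l) x \<le> 1 / real (Suc k)"
      using S(3)[of k] x unfolding osc_le_def by blast
    have "blinfun_apply (d j) x - blinfun_apply (d l) x \<le> 1 / real (Suc k)"
      if "max N (Suc k) \<le> j" "max N (Suc k) \<le> l" for j l
      using that by (intro hull_diff_le[OF N d_mem d_mem]) auto
    then have "dist (blinfun_apply (d j) x) (blinfun_apply (d l) x) < e"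
      if "max N (Suc k) \<le> j" "max N (Suc k) \<le> l" for j l
      using that k unfolding dist_real_def by (smt (verit))
    then show "\<exists>M. \<forall>j\<ge>M. \<forall>l\<ge>M. dist (blinfun_apply (d j) x) (blinfun_apply (d l) x) < e"
      by blast
  qed
  have "convergent (\<lambda>n. blinfun_apply (d n) x)" for x
  proof -
    \<comment> \<open>The oscillation bound speaks of the unit ball only; dividing by
      \<open>norm x + 1\<close> moves \<open>x\<close> there and also covers
      \<open>x = 0\<close>.\<close>
    define y where "y = (1 / (norm x + 1)) *\<^sub>R x"
    have pos: "norm x + 1 > 0" using norm_ge_zero[of x] by linarith
    have "convergent (\<lambda>n. blinfun_apply (d n) y)"
      using pos by (intro Cauchy_convergent ball) (simp add: y_def)
    then have "convergent (\<lambda>n. (norm x + 1) * blinfun_apply (d n) y)"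
      by (intro convergent_mult convergent_const)
    then show ?thesis using pos by (simp add: y_def blinfun.scaleR_right)
  qed
  then have "Cauchy d"
    using weak_star_null_differences[of d] convex_block_norm[OF d bound] none by blast
  then show ?thesis using d Cauchy_convergent by blast
qed

section \<open>Extraction of subsequences and countable norming sets\<close>

lemma nonconvergent_subsequences:
  fixes a :: "nat \<Rightarrow> real"
  assumes bound: "\<And>n. \<bar>a n\<bar> \<le> B" and "\<not> convergent a"
  shows "\<exists>r s l m. strict_mono r \<and> strict_mono s \<and> (a \<circ> r) \<longlonglongrightarrow> l \<and> (a \<circ> s) \<longlonglongrightarrow> m \<and> l \<noteq> m"
proof -
  have sub: "\<exists>l r. strict_mono (r :: nat \<Rightarrow> nat) \<and> (b \<circ> r) \<longlonglongrightarrow> l" if "\<And>n. \<bar>b n\<bar> \<le> B" for b :: "nat \<Rightarrow> real"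
  proof -
    have "\<forall>n. b n \<in> {- B..B}" using that by (simp add: abs_le_iff minus_le_iff)
    then show ?thesis
      using compact_imp_seq_compact[OF compact_Icc, of "- B" B] unfolding seq_compact_def by blast
  qed
  obtain l r where r: "strict_mono r" "(a \<circ> r) \<longlonglongrightarrow> l" using sub[of a] bound by auto
  have "\<not> a \<longlonglongrightarrow> l" using assms(2) by (auto simp: convergent_def)
  then obtain e where e: "e > 0" "\<And>N. \<exists>n\<ge>N. e \<le> \<bar>a n - l\<bar>"
    by (auto simp: LIMSEQ_iff not_less)
  \<comment> \<open>These indices form a subsequence staying \<open>e\<close> away from
    \<open>l\<close>, so any limit along it differs from \<open>l\<close>.\<close>
  then have "infinite {n. e \<le> \<bar>a n - l\<bar>}"
    unfolding infinite_nat_iff_unbounded_le by blast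
  then obtain s0 :: "nat \<Rightarrow> nat" where s0: "strict_mono s0" "\<And>n. e \<le> \<bar>a (s0 n) - l\<bar>"
    using infinite_enumerate by blast
  obtain m s1 where s1: "strict_mono s1" "(a \<circ> s0 \<circ> s1) \<longlonglongrightarrow> m"
    using sub[of "a \<circ> s0"] bound by auto
  have "(\<lambda>n. \<bar>(a \<circ> s0 \<circ> s1) n - l\<bar>) \<longlonglongrightarrow> \<bar>m - l\<bar>"
    using s1(2) by (intro tendsto_intros)
  then have "e \<le> \<bar>m - l\<bar>"
    using s0(2) by (intro LIMSEQ_le_const) auto
  then have "l \<noteq> m" using e(1) by auto
  then show ?thesis
    using r s1 strict_mono_o[OF s0(1) s1(1)] by (metis comp_assoc)
qed

text \<open>Otherwise \<open>norm v / 2\<close> would bound the operator norm, forcing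
  \<open>v = 0\<close>; but then the point \<open>0\<close> works.\<close>

lemma blinfun_half_norm_attained:
  fixes v :: "'a::real_normed_vector \<Rightarrow>\<^sub>L real"
  shows "\<exists>x. norm x \<le> 1 \<and> norm v / 2 \<le> \<bar>blinfun_apply v x\<bar>"
proof (rule ccontr)
  assume not: "\<not> ?thesis"
  have "norm (blinfun_apply v x) \<le> norm v / 2 * norm x" for x
  proof (cases "x = 0")
    case False
    then have "norm ((1 / norm x) *\<^sub>R x) \<le> 1" by simp
    then have "\<bar>blinfun_apply v ((1 / norm x) *\<^sub>R x)\<bar> < norm v / 2"
      using not by (meson not_le)
    then show ?thesis using False by (simp add: blinfun.scaleR_right field_simps)
  qed simp
  then have "norm v \<le> norm v / 2" by (intro norm_blinfun_bound) auto
  then have "norm v = 0" using norm_ge_zero[of v] by linarith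
  then show False using not by (auto dest!: spec[of _ 0])
qed

text \<open>Rational combinations of the \<open>f i\<close> are countable and dense in the closed
  span. A point half norming each of them suffices, by approximation.\<close>

lemma countable_norming_points:
  fixes f :: "nat \<Rightarrow> 'a::real_normed_vector \<Rightarrow>\<^sub>L real"
  shows "\<exists>c :: nat \<Rightarrow> 'a. \<forall>u \<in> closure (span (range f)). (\<forall>k. blinfun_apply u (c k) = 0) \<longrightarrow> u = 0"
proof -
  define w :: "(rat \<times> nat) list \<Rightarrow> 'a \<Rightarrow>\<^sub>L real"
    where "w q = (\<Sum>(c, i)\<leftarrow>q. real_of_rat c *\<^sub>R f i)" for q
  have dense: "span (range f) \<subseteq> closure (range w)"
  proof
    fix u assume "u \<in> span (range f)"
    then show "u \<in> closure (range w)"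
    proof (induction rule: span_induct_alt)
      case base
      have "w [] = 0" by (simp add: w_def)
      then show ?case using closure_subset by (metis rangeI subsetD)
    next
      case (step c v y)
      then obtain i where i: "v = f i" by auto
      show ?case unfolding closure_approachable
      proof (intro allI impI)
        fix e :: real assume e: "e > 0"
        then obtain q where q: "dist (w q) y < e / 2"
          using step.IH[unfolded closure_approachable] by (auto dest!: spec[of _ "e / 2"])
        \<comment> \<open>Chosen so that replacing \<open>c\<close> by a rational within
          \<open>h\<close> costs at most \<open>e / 2\<close>; the \<open>+ 1\<close> avoids
          division by zero.\<close>
        define h where "h = e / (2 * (norm (f i) + 1))"
        have nf: "norm (f i) + 1 > 0" using norm_ge_zero[of "f i"] by linarith
        then have "c - h < c + h" using e by (simp add: h_def)
        then obtain r where r: "c - h < real_of_rat r" "real_of_rat r < c + h"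
          using of_rat_dense by blast
        have "\<bar>real_of_rat r - c\<bar> * norm (f i) \<le> h * norm (f i)"
          using r by (intro mult_right_mono) auto
        also have "\<dots> \<le> e / 2"
          using e nf by (simp add: h_def field_simps)
        finally have "norm ((real_of_rat r - c) *\<^sub>R f i) \<le> e / 2" by simp
        then have "norm ((real_of_rat r - c) *\<^sub>R f i + (w q - y)) < e"
          using q norm_triangle_ineq[of "(real_of_rat r - c) *\<^sub>R f i" "w q - y"]
          unfolding dist_norm by linarith
        moreover have "(real_of_rat r - c) *\<^sub>R f i + (w q - y) = w ((r, i) # q) - (c *\<^sub>R v + y)"
          by (simp add: w_def i algebra_simps)
        ultimately have "dist (w ((r, i) # q)) (c *\<^sub>R v + y) < e" by (simp add: dist_norm)
        then show "\<exists>z\<in>range w. dist z (c *\<^sub>R v + y) < e" by blast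
      qed
    qed
  qed
  obtain p where p: "\<And>v :: 'a \<Rightarrow>\<^sub>L real. norm (p v) \<le> 1"
    "\<And>v. norm v / 2 \<le> \<bar>blinfun_apply v (p v)\<bar>"
    using blinfun_half_norm_attained by metis
  have "u = 0" if u: "u \<in> closure (span (range f))"
    and zero: "\<And>k. blinfun_apply u (p (w (from_nat k))) = 0" for u
  proof -
    have "norm u \<le> e" if "e > 0" for e
    proof -
      have "u \<in> closure (range w)" using u dense closure_minimal[OF dense] by auto
      then obtain q where q: "dist (w q) u < e / 3"
        using \<open>e > 0\<close> unfolding closure_approachable by (auto dest!: spec[of _ "e / 3"])
      \<comment> \<open>As \<open>u\<close> vanishes at the point norming \<open>w q\<close>, this
        leads to \<open>norm (w q) \<le> 2 * norm (w q - u)\<close>, hence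
        \<open>norm u \<le> 3 * norm (w q - u)\<close>, which explains \<open>e / 3\<close>.\<close>
      have "norm (w q) / 2 \<le> \<bar>blinfun_apply (w q - u) (p (w q))\<bar>"
        using p(2)[of "w q"] zero[of "to_nat q"] by (simp add: blinfun.diff_left)
      also have "\<dots> \<le> norm (w q - u) * norm (p (w q))"
        using norm_blinfun[of "w q - u" "p (w q)"] by simp
      also have "\<dots> \<le> norm (w q - u)" using p(1)[of "w q"] by (simp add: mult_left_le)
      finally show ?thesis
        using q norm_triangle_ineq4[of "w q" "w q - u"] by (simp add: dist_norm)
    qed
    then have "norm u \<le> 0" by (rule field_le_epsilon[where y = 0, simplified])
    then show ?thesis by simp
  qed
  then show ?thesis by (intro exI[of _ "\<lambda>k. p (w (from_nat k))"]) auto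
qed

lemma convergent_on_countable_subsequence:
  fixes h :: "nat \<Rightarrow> nat \<Rightarrow> real"
  assumes "\<And>k n. \<bar>h k n\<bar> \<le> B k"
  shows "\<exists>r. strict_mono (r :: nat \<Rightarrow> nat) \<and> (\<forall>k. convergent (\<lambda>n. h k (r n)))"
proof -
  interpret subseqs "\<lambda>k s. convergent (h k \<circ> s)"
  proof
    fix k and s :: "nat \<Rightarrow> nat"
    have "\<forall>n. (h k \<circ> s) n \<in> {- B k..B k}" using assms by (simp add: abs_le_iff minus_le_iff)
    then obtain l r where "strict_mono (r :: nat \<Rightarrow> nat)" "(h k \<circ> s \<circ> r) \<longlonglongrightarrow> l"
      using compact_imp_seq_compact[OF compact_Icc, of "- B k" "B k"] unfolding seq_compact_def by blast
    then show "\<exists>r'. strict_mono r' \<and> convergent (h k \<circ> (s \<circ> r'))"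
      by (auto simp: convergent_def comp_assoc)
  qed
  \<comment> \<open>The diagonal sequence refines the \<open>k\<close>-th selection only from index
    \<open>Suc k\<close> on; convergence ignores the initial segment.\<close>
  have "convergent (h k \<circ> (diagseq \<circ> ((+) (Suc k))))" for k
    by (rule diagseq_holds) (metis comp_assoc convergent_subseq_convergent)
  moreover have "h k \<circ> (diagseq \<circ> ((+) (Suc k))) = (\<lambda>n. h k (diagseq (n + Suc k)))" for k
    by (simp add: fun_eq_iff add.commute)
  ultimately have "convergent (\<lambda>n. h k (diagseq (n + Suc k)))" for k by simp
  then have "convergent (\<lambda>n. h k (diagseq n))" for k
    by (rule convergent_ignore_initial_segment[THEN iffD1])
  then show ?thesis using subseq_diagseq by blast
qed

text \<open>Separation carries the infinite dimension: no subsequence is norm Cauchy, so a pointwise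
  convergent one already yields the desired sequence through its differences.\<close>

lemma josefson_nissenzweig:
  fixes f :: "nat \<Rightarrow> 'a::real_normed_vector \<Rightarrow>\<^sub>L real"
  assumes bound: "\<And>n. norm (f n) \<le> 1"
    and sep: "\<And>m n. m \<noteq> n \<Longrightarrow> 1 \<le> norm (f m - f n)"
  shows "\<exists>c g :: nat \<Rightarrow> 'a \<Rightarrow>\<^sub>L real. weak_star_null c g"
proof (rule ccontr)
  assume "\<not> ?thesis"
  then have none: "\<not> weak_star_null c g" for c and g :: "nat \<Rightarrow> 'a \<Rightarrow>\<^sub>L real" by blast
  have abs: "\<bar>blinfun_apply (f n) x\<bar> \<le> norm x" for n x
  proof -
    have "\<bar>blinfun_apply (f n) x\<bar> \<le> norm (f n) * norm x" using norm_blinfun[of "f n" x] by simp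
    also have "\<dots> \<le> norm x" using bound[of n] by (simp add: mult_left_le_one_le)
    finally show ?thesis .
  qed
  obtain c :: "nat \<Rightarrow> 'a" where
    c: "\<And>u. u \<in> closure (span (range f)) \<Longrightarrow> (\<And>k. blinfun_apply u (c k) = 0) \<Longrightarrow> u = 0"
    using countable_norming_points[of f] by blast
  obtain r where r: "strict_mono r" "\<And>k. convergent (\<lambda>n. blinfun_apply (f (r n)) (c k))"
    using convergent_on_countable_subsequence[of "\<lambda>k n. blinfun_apply (f n) (c k)" "\<lambda>k. norm (c k)"] abs
    by auto
  \<comment> \<open>\<open>u\<close> is a norm limit of convex blocks along \<open>a\<close>. It
    reproduces every pointwise limit along \<open>a\<close> and stays in the closed span, where the
    points \<open>c k\<close> separate.\<close>
  have block: "\<exists>u. u \<in> closure (span (range f)) \<and>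
      (\<forall>x l. (\<lambda>n. blinfun_apply (f (r (a n))) x) \<longlonglongrightarrow> l \<longrightarrow> blinfun_apply u x = l)" for a :: "nat \<Rightarrow> nat"
  proof -
    obtain s u where s: "convex_block (\<lambda>n. f (r (a n))) s" "s \<longlonglongrightarrow> u"
      using convergent_convex_block[of "\<lambda>n. f (r (a n))"] bound none by (auto simp: convergent_def)
    have "s n \<in> span (range f)" for n
      using s(1) convex_hull_subset_span[of "(\<lambda>n. f (r (a n))) ` {n..}"]
        span_mono[of "(\<lambda>n. f (r (a n))) ` {n..}" "range f"]
      by (auto simp: convex_block_def)
    then have "u \<in> closure (span (range f))"
      using s(2) closure_sequential by blast
    moreover have "blinfun_apply u x = l" if "(\<lambda>n. blinfun_apply (f (r (a n))) x) \<longlonglongrightarrow> l" for x l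
    proof -
      have "(\<lambda>n. blinfun_apply (s n) x) \<longlonglongrightarrow> l"
        by (rule convex_block_tendsto[OF s(1) linear_blinfun_apply_at that])
      moreover have "(\<lambda>n. blinfun_apply (s n) x) \<longlonglongrightarrow> blinfun_apply u x"
        using s(2) by (intro tendsto_intros)
      ultimately show ?thesis by (rule LIMSEQ_unique[symmetric])
    qed
    ultimately show ?thesis by blast
  qed
  have "convergent (\<lambda>n. blinfun_apply (f (r n)) x)" for x
  proof (rule ccontr)
    assume "\<not> ?thesis"
    from nonconvergent_subsequences[OF _ this, of "norm x"] abs obtain a b l m where
      ab: "strict_mono a" "strict_mono b"
        "(\<lambda>n. blinfun_apply (f (r (a n))) x) \<longlonglongrightarrow> l" "(\<lambda>n. blinfun_apply (f (r (b n))) x) \<longlonglongrightarrow> m"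
        "l \<noteq> m"
      by (auto simp: o_def)
    obtain u where u: "u \<in> closure (span (range f))"
      "\<And>x l. (\<lambda>n. blinfun_apply (f (r (a n))) x) \<longlonglongrightarrow> l \<Longrightarrow> blinfun_apply u x = l"
      using block[of a] by blast
    obtain v where v: "v \<in> closure (span (range f))"
      "\<And>x l. (\<lambda>n. blinfun_apply (f (r (b n))) x) \<longlonglongrightarrow> l \<Longrightarrow> blinfun_apply v x = l"
      using block[of b] by blast
    \<comment> \<open>At each \<open>c k\<close> the sequence along \<open>r\<close> converges, so
      both of its subsequences give the same value there.\<close>
    have "u - v = 0"
    proof (rule c)
      show "u - v \<in> closure (span (range f))"
      proof -
        obtain p q where "\<And>n. p n \<in> span (range f)" "p \<longlonglongrightarrow> u" "\<And>n. q n \<in> span (range f)" "q \<longlonglongrightarrow> v"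
          using u(1) v(1) unfolding closure_sequential by blast
        then have "\<And>n. p n - q n \<in> span (range f)" "(\<lambda>n. p n - q n) \<longlonglongrightarrow> u - v"
          by (auto intro: span_diff tendsto_diff)
        then show ?thesis
          unfolding closure_sequential by (intro exI[of _ "\<lambda>n. p n - q n"]) auto
      qed
    next
      fix k
      obtain L where L: "(\<lambda>n. blinfun_apply (f (r n)) (c k)) \<longlonglongrightarrow> L"
        using r(2)[of k] by (auto simp: convergent_def)
      have "blinfun_apply u (c k) = L" "blinfun_apply v (c k) = L"
        using u(2) v(2) LIMSEQ_subseq_LIMSEQ[OF L ab(1)] LIMSEQ_subseq_LIMSEQ[OF L ab(2)]
        by (auto simp: o_def)
      then show "blinfun_apply (u - v) (c k) = 0" by (simp add: blinfun.diff_left)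
    qed
    then show False using u(2)[OF ab(3)] v(2)[OF ab(4)] ab(5) by simp
  qed
  moreover have "\<not> Cauchy (\<lambda>n. f (r n))"
  proof
    assume "Cauchy (\<lambda>n. f (r n))"
    then obtain N where "\<forall>m\<ge>N. \<forall>n\<ge>N. dist (f (r m)) (f (r n)) < 1"
      unfolding Cauchy_def using zero_less_one by blast
    then have "dist (f (r N)) (f (r (Suc N))) < 1" by simp
    moreover have "r N \<noteq> r (Suc N)" using r(1) strict_mono_eq by fastforce
    ultimately show False using sep[of "r N" "r (Suc N)"] by (simp add: dist_norm)
  qed
  ultimately show False
    using weak_star_null_differences[of "\<lambda>n. f (r n)"] bound none by blast
qed

section \<open>Complex functionals and homogeneous polynomials\<close>

text \<open>The common kernel has finite codimension: every vector enters it after subtraction of a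
  member of a fixed finite-dimensional span. A vector outside that span leaves a nonzero
  remainder.\<close>

lemma common_kernel:
  fixes f :: "nat \<Rightarrow> 'a::real_vector \<Rightarrow> real"
  assumes inf: "\<not> (\<exists>B :: 'a set. finite B \<and> span B = UNIV)" and lin: "\<And>i. linear (f i)"
  shows "\<exists>x. x \<noteq> 0 \<and> (\<forall>i<k. f i x = 0)"
proof -
  have "\<exists>B. finite B \<and> (\<forall>x. \<exists>b\<in>span B. \<forall>i<k. f i (x - b) = 0)"
  proof (induction k)
    case 0
    show ?case by (intro exI[of _ "{}"]) auto
  next
    case (Suc k)
    then obtain B where B: "finite B" "\<And>x. \<exists>b\<in>span B. \<forall>i<k. f i (x - b) = 0" by blast
    show ?case
    proof (cases "\<exists>w. (\<forall>i<k. f i w = 0) \<and> f k w \<noteq> 0")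
      case True
      then obtain w where w: "\<And>i. i < k \<Longrightarrow> f i w = 0" "f k w \<noteq> 0" by blast
      have "\<exists>b\<in>span (insert w B). \<forall>i<Suc k. f i (x - b) = 0" for x
      proof -
        obtain b where b: "b \<in> span B" "\<And>i. i < k \<Longrightarrow> f i (x - b) = 0" using B(2) by blast
        \<comment> \<open>The coefficient of \<open>w\<close> cancels \<open>f k\<close>, and the
          earlier functionals do not see \<open>w\<close>.\<close>
        define b' where "b' = b + (f k (x - b) / f k w) *\<^sub>R w"
        have "b' \<in> span (insert w B)"
          unfolding b'_def using b(1) span_mono[of B "insert w B"]
          by (intro span_add span_scale) (auto intro: span_base)
        moreover have "f i (x - b') = f i (x - b) - f k (x - b) / f k w * f i w" for i
          using lin[of i] by (simp add: b'_def linear_diff linear_add linear_scale)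
        then have "\<forall>i<Suc k. f i (x - b') = 0" using b(2) w by (auto simp: less_Suc_eq)
        ultimately show ?thesis by blast
      qed
      then show ?thesis using B(1) by (intro exI[of _ "insert w B"]) auto
    next
      case False
      then have "\<exists>b\<in>span B. \<forall>i<Suc k. f i (x - b) = 0" for x
        using B(2)[of x] by (auto simp: less_Suc_eq)
      then show ?thesis using B(1) by blast
    qed
  qed
  then obtain B where B: "finite B" "\<And>x. \<exists>b\<in>span B. \<forall>i<k. f i (x - b) = 0" by blast
  obtain x where x: "x \<notin> span B" using inf B(1) by blast
  obtain b where "b \<in> span B" "\<forall>i<k. f i (x - b) = 0" using B(2) by blast
  then show ?thesis using x by (intro exI[of _ "x - b"]) auto
qed

text \<open>Each new functional norms a nonzero vector on which all earlier ones vanish; that vector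
  witnesses the distance.\<close>

lemma separated_functionals:
  assumes inf: "\<not> (\<exists>B :: 'a::real_normed_vector set. finite B \<and> span B = UNIV)"
  shows "\<exists>f :: nat \<Rightarrow> 'a \<Rightarrow>\<^sub>L real. (\<forall>n. norm (f n) \<le> 1) \<and> (\<forall>m n. m \<noteq> n \<longrightarrow> 1 \<le> norm (f m - f n))"
proof -
  have "\<exists>f :: nat \<Rightarrow> 'a \<Rightarrow>\<^sub>L real. \<forall>n. norm (f n) \<le> 1 \<and> (\<forall>i<n. 1 \<le> norm (f i - f n))"
  proof (rule dependent_wellorder_choice)
    fix n and f :: "nat \<Rightarrow> 'a \<Rightarrow>\<^sub>L real"
    obtain x where x: "x \<noteq> 0" "\<And>i. i < n \<Longrightarrow> blinfun_apply (f i) x = 0"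
      using common_kernel[OF inf, of "\<lambda>i. blinfun_apply (f i)" n]
      by (auto intro: bounded_linear.linear blinfun.bounded_linear_right)
    obtain g :: "'a \<Rightarrow>\<^sub>L real" where g: "norm g \<le> 1" "blinfun_apply g x = norm x"
      using norming_functional by blast
    have "1 \<le> norm (f i - g)" if "i < n" for i
    proof -
      have "norm x = norm (blinfun_apply (f i - g) x)" using g(2) x(2)[OF that] by (simp add: blinfun.diff_left)
      also have "\<dots> \<le> norm (f i - g) * norm x" by (rule norm_blinfun)
      finally show ?thesis using x(1) by simp
    qed
    then show "\<exists>g. norm g \<le> 1 \<and> (\<forall>i<n. 1 \<le> norm (f i - g))" using g(1) by blast
  qed auto
  then obtain f :: "nat \<Rightarrow> 'a \<Rightarrow>\<^sub>L real" where
    f: "\<And>n. norm (f n) \<le> 1" "\<And>i n. i < n \<Longrightarrow> 1 \<le> norm (f i - f n)" by blast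
  have "1 \<le> norm (f m - f n)" if "m \<noteq> n" for m n
    using f(2)[of m n] f(2)[of n m] that by (cases "m < n") (auto simp: norm_minus_commute)
  then show ?thesis using f(1) by blast
qed

text \<open>The real span lies in the complex span, so a finite real spanning set would also span
  over the complex numbers.\<close>

lemma infinite_real_dimension:
  assumes "\<not> (\<exists>B :: 'a::complex_normed_vector set. finite B \<and> module.span scaleC B = UNIV)"
  shows "\<not> (\<exists>B :: 'a set. finite B \<and> span B = UNIV)"
proof
  interpret C: vector_space "scaleC :: complex \<Rightarrow> 'a \<Rightarrow> 'a" by (rule vector_space_scaleC)
  assume "\<exists>B :: 'a set. finite B \<and> span B = UNIV"
  then obtain B :: "'a set" where B: "finite B" "span B = UNIV" by blast
  have "span B \<subseteq> C.span B"
  proof (rule span_minimal)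
    show "subspace (C.span B)"
      unfolding subspace_def
      by (auto simp: C.span_zero C.span_add scaleC_of_real[symmetric] intro: C.span_scale)
  qed (rule C.span_superset)
  then show False using assms B by auto
qed

section \<open>Continuous complex-linear functionals\<close>

definition bounded_functional :: "('a::complex_normed_vector \<Rightarrow> complex) \<Rightarrow> bool" where
  "bounded_functional \<phi> \<longleftrightarrow> (\<forall>x y. \<phi> (x + y) = \<phi> x + \<phi> y) \<and> (\<forall>c x. \<phi> (c *\<^sub>C x) = c * \<phi> x) \<and>
     (\<exists>K. \<forall>x. cmod (\<phi> x) \<le> K * norm x)"

lemma bounded_functional_add: "bounded_functional \<phi> \<Longrightarrow> \<phi> (x + y) = \<phi> x + \<phi> y"
  and bounded_functional_scaleC: "bounded_functional \<phi> \<Longrightarrow> \<phi> (c *\<^sub>C x) = c * \<phi> x"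
  and bounded_functional_bound: "bounded_functional \<phi> \<Longrightarrow> \<exists>K. \<forall>x. cmod (\<phi> x) \<le> K * norm x"
  by (auto simp: bounded_functional_def)

lemma bounded_functional_scaleR:
  "bounded_functional \<phi> \<Longrightarrow> \<phi> (r *\<^sub>R x) = complex_of_real r * \<phi> x"
  using bounded_functional_scaleC[of \<phi> "complex_of_real r" x] by (simp add: scaleC_of_real)

lemma bounded_functional_bounded_linear:
  assumes "bounded_functional \<phi>"
  shows "bounded_linear \<phi>"
proof -
  obtain K where "\<And>x. cmod (\<phi> x) \<le> K * norm x" using bounded_functional_bound[OF assms] by blast
  then show ?thesis
    by (intro bounded_linear_intro[where K = K])
       (simp_all add: bounded_functional_add[OF assms] bounded_functional_scaleR[OF assms]
         scaleR_conv_of_real mult.commute)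
qed

lemma bounded_functional_combination:
  assumes \<phi>: "bounded_functional \<phi>" and \<psi>: "bounded_functional \<psi>"
  shows "bounded_functional (\<lambda>x. a * \<phi> x + b * \<psi> x)"
proof -
  obtain K L where K: "\<And>x. cmod (\<phi> x) \<le> K * norm x" and L: "\<And>x. cmod (\<psi> x) \<le> L * norm x"
    using bounded_functional_bound[OF \<phi>] bounded_functional_bound[OF \<psi>] by blast
  have "cmod (a * \<phi> x + b * \<psi> x) \<le> (cmod a * K + cmod b * L) * norm x" for x
  proof -
    have "cmod (a * \<phi> x + b * \<psi> x) \<le> cmod a * cmod (\<phi> x) + cmod b * cmod (\<psi> x)"
      using norm_triangle_ineq[of "a * \<phi> x" "b * \<psi> x"] by (simp add: norm_mult)
    also have "\<dots> \<le> cmod a * (K * norm x) + cmod b * (L * norm x)"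
      by (intro add_mono mult_left_mono K L) auto
    finally show ?thesis by (simp add: algebra_simps)
  qed
  then have "\<exists>M. \<forall>x. cmod (a * \<phi> x + b * \<psi> x) \<le> M * norm x" by blast
  then show ?thesis
    by (simp add: bounded_functional_def bounded_functional_add[OF \<phi>] bounded_functional_add[OF \<psi>]
        bounded_functional_scaleC[OF \<phi>] bounded_functional_scaleC[OF \<psi>] algebra_simps)
qed

text \<open>The unique complex-linear functional with real part \<open>u\<close>: complex linearity
  dictates the imaginary part.\<close>

definition complexify :: "('a::complex_normed_vector \<Rightarrow>\<^sub>L real) \<Rightarrow> 'a \<Rightarrow> complex" where
  "complexify u x = Complex (blinfun_apply u x) (- blinfun_apply u (\<i> *\<^sub>C x))"

lemma scaleC_Complex: "c *\<^sub>C x = Re c *\<^sub>R x + Im c *\<^sub>R (\<i> *\<^sub>C x)"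
proof -
  have "c = complex_of_real (Re c) + complex_of_real (Im c) * \<i>"
    by (simp add: complex_eq_iff)
  then have "c *\<^sub>C x = (complex_of_real (Re c) + complex_of_real (Im c) * \<i>) *\<^sub>C x"
    by (rule arg_cong)
  then show ?thesis
    unfolding scaleC_add_left scaleC_scaleC[symmetric] scaleC_of_real .
qed

lemma complexify_scaleC: "complexify u (c *\<^sub>C x) = c * complexify u x"
proof -
  have eq: "blinfun_apply u (d *\<^sub>C x) = Re d * blinfun_apply u x + Im d * blinfun_apply u (\<i> *\<^sub>C x)" for d
    by (subst scaleC_Complex) (simp add: blinfun.add_right blinfun.scaleR_right)
  have "\<i> *\<^sub>C c *\<^sub>C x = (\<i> * c) *\<^sub>C x" by (rule scaleC_scaleC)
  then show ?thesis
    by (simp add: complexify_def complex_eq_iff eq[of c] eq[of "\<i> * c"])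
qed

text \<open>Rotating \<open>x\<close> by a unimodular \<open>\<theta>\<close> makes the value real
  and positive, where it coincides with that of \<open>u\<close>.\<close>

lemma cmod_complexify_le: "cmod (complexify u x) \<le> norm u * norm x"
proof (cases "complexify u x = 0")
  case False
  define \<theta> where "\<theta> = cnj (complexify u x) / cmod (complexify u x)"
  have "complexify u (\<theta> *\<^sub>C x) = complexify u x * cnj (complexify u x) / cmod (complexify u x)"
    by (simp add: complexify_scaleC \<theta>_def)
  also have "\<dots> = cmod (complexify u x)"
    unfolding complex_norm_square[symmetric] using False by (simp add: power2_eq_square)
  finally have "complexify u (\<theta> *\<^sub>C x) = cmod (complexify u x)" .
  then have "cmod (complexify u x) = blinfun_apply u (\<theta> *\<^sub>C x)"
    by (simp add: complexify_def complex_eq_iff)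
  also have "\<dots> \<le> norm u * norm (\<theta> *\<^sub>C x)" using norm_blinfun[of u "\<theta> *\<^sub>C x"] by simp
  also have "norm (\<theta> *\<^sub>C x) = norm x" using False by (simp add: norm_scaleC \<theta>_def norm_divide)
  finally show ?thesis .
qed simp

lemma bounded_functional_complexify: "bounded_functional (complexify u)"
  unfolding bounded_functional_def
proof (intro conjI allI)
  show "complexify u (x + y) = complexify u x + complexify u y" for x y
    by (simp add: complexify_def complex_eq_iff scaleC_add_right blinfun.add_right)
qed (auto simp: complexify_scaleC intro: cmod_complexify_le)

lemma tendsto_complexify:
  assumes "\<And>x. (\<lambda>n. blinfun_apply (g n) x) \<longlonglongrightarrow> 0"
  shows "(\<lambda>n. complexify (g n) x) \<longlonglongrightarrow> 0"
proof -
  have "(\<lambda>n. complexify (g n) x) \<longlonglongrightarrow> Complex 0 (- 0)"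
    unfolding complexify_def by (intro tendsto_intros assms)
  then show ?thesis by (simp add: zero_complex.code)
qed

section \<open>Homogeneous polynomials and their pairing with tensors\<close>

lemma vector_space_complex: "vector_space ((*) :: complex \<Rightarrow> complex \<Rightarrow> complex)"
  by unfold_locales (simp_all add: algebra_simps)

text \<open>The product of the functionals in separate arguments is averaged over all permutations
  to become symmetric; on the diagonal the \<open>n!\<close> terms agree.\<close>

lemma product_hom_polys:
  fixes \<phi> :: "nat \<Rightarrow> 'a::complex_normed_vector \<Rightarrow> complex"
  assumes \<phi>: "\<And>i. bounded_functional (\<phi> i)"
  shows "(\<lambda>x. \<Prod>i<n. \<phi> i x) \<in> hom_polys n"
proof -
  let ?S = "{\<sigma>. \<sigma> permutes {..<n}}"
  define T where "T \<sigma> v = (\<Prod>j<n. \<phi> j (v (\<sigma> j)))" for \<sigma> :: "nat \<Rightarrow> nat" and v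
  define A where "A v = (\<Sum>\<sigma>\<in>?S. T \<sigma> v) / fact n" for v
  \<comment> \<open>A permutation sends exactly one factor to the slot \<open>i\<close>, so
    \<open>T \<sigma>\<close> depends on that slot through a multiple of a single
    functional.\<close>
  have slot: "\<exists>c. \<exists>j. \<forall>x. T \<sigma> (v(i := x)) = c * \<phi> j x" if \<sigma>: "\<sigma> \<in> ?S" and i: "i < n" for \<sigma> v i
  proof -
    obtain j where j: "j < n" "\<sigma> j = i"
      using permutes_image[of \<sigma> "{..<n}"] \<sigma> i by (metis (mono_tags) imageE lessThan_iff mem_Collect_eq)
    have inj: "\<sigma> l \<noteq> i" if "l \<noteq> j" for l
      using permutes_inj[of \<sigma>] \<sigma> j that by (auto dest: injD)
    have "T \<sigma> (v(i := x)) = (\<Prod>l\<in>{..<n} - {j}. \<phi> l (v (\<sigma> l))) * \<phi> j x" for x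
    proof -
      have "T \<sigma> (v(i := x)) = \<phi> j x * (\<Prod>l\<in>{..<n} - {j}. \<phi> l ((v(i := x)) (\<sigma> l)))"
        unfolding T_def using prod.remove[of "{..<n}" j "\<lambda>l. \<phi> l ((v(i := x)) (\<sigma> l))"] j by simp
      also have "(\<Prod>l\<in>{..<n} - {j}. \<phi> l ((v(i := x)) (\<sigma> l))) = (\<Prod>l\<in>{..<n} - {j}. \<phi> l (v (\<sigma> l)))"
        using inj by (intro prod.cong) auto
      finally show ?thesis by (simp only: mult.commute)
    qed
    then show ?thesis by blast
  qed
  have T_add: "T \<sigma> (v(i := x + y)) = T \<sigma> (v(i := x)) + T \<sigma> (v(i := y))"
    and T_scale: "T \<sigma> (v(i := c *\<^sub>C x)) = c * T \<sigma> (v(i := x))"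
    if *: "\<sigma> \<in> ?S" "i < n" for \<sigma> v i x y c
  proof -
    obtain d j where "\<And>x. T \<sigma> (v(i := x)) = d * \<phi> j x" using slot[OF *] by blast
    then show "T \<sigma> (v(i := x + y)) = T \<sigma> (v(i := x)) + T \<sigma> (v(i := y))"
      "T \<sigma> (v(i := c *\<^sub>C x)) = c * T \<sigma> (v(i := x))"
      by (simp_all add: bounded_functional_add[OF \<phi>] bounded_functional_scaleC[OF \<phi>] algebra_simps)
  qed
  have "multilinear_form n A"
    unfolding multilinear_form_def
  proof (intro conjI allI impI)
    fix v w :: "nat \<Rightarrow> 'a" assume "\<forall>i<n. v i = w i"
    then have "T \<sigma> v = T \<sigma> w" if "\<sigma> \<in> ?S" for \<sigma>
      using that permutes_in_image[of \<sigma> "{..<n}"] unfolding T_def by (intro prod.cong) auto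
    then show "A v = A w" by (simp add: A_def)
  next
    fix i v assume i: "i < n"
    have "A (v(i := x + y)) = A (v(i := x)) + A (v(i := y))" for x y
      unfolding A_def add_divide_distrib[symmetric] sum.distrib[symmetric]
      using T_add[OF _ i] by (intro arg_cong2[where f = "(/)"] sum.cong) auto
    moreover have "A (v(i := c *\<^sub>C x)) = c * A (v(i := x))" for c x
      unfolding A_def times_divide_eq_right sum_distrib_left
      using T_scale[OF _ i] by (intro arg_cong2[where f = "(/)"] sum.cong) auto
    ultimately show "Vector_Spaces.linear (*\<^sub>C) (*) (\<lambda>x. A (v(i := x)))"
      by (simp add: Vector_Spaces.linear_iff vector_space_scaleC vector_space_complex)
  qed
  moreover have "symmetric_form n A"
    unfolding symmetric_form_def
  proof (intro allI impI)
    fix \<tau> and v :: "nat \<Rightarrow> 'a" assume "\<tau> permutes {..<n}"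
    then have "(\<Sum>\<sigma>\<in>?S. T \<sigma> v) = (\<Sum>\<sigma>\<in>?S. T (\<tau> \<circ> \<sigma>) v)"
      by (rule setum_permutations_compose_left)
    then show "A (v \<circ> \<tau>) = A v" by (simp add: A_def T_def)
  qed
  moreover have "continuous_on UNIV A"
  proof -
    have "continuous_on UNIV (\<lambda>v. \<phi> j (v (\<sigma> j)))" for j and \<sigma> :: "nat \<Rightarrow> nat"
      by (rule bounded_linear.continuous_on[OF bounded_functional_bounded_linear[OF \<phi>]
            continuous_on_product_coordinates])
    then show ?thesis unfolding A_def T_def by (intro continuous_intros) auto
  qed
  moreover have "(\<Prod>i<n. \<phi> i x) = A (\<lambda>_. x)" for x
    by (simp add: A_def T_def card_permutations)
  ultimately have "represents n A (\<lambda>x. \<Prod>i<n. \<phi> i x)" by (simp add: represents_def)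
  then show ?thesis by (auto simp: hom_polys_def)
qed

lemma hom_polys_add:
  assumes "P \<in> hom_polys n" "Q \<in> hom_polys n"
  shows "(\<lambda>x. P x + Q x) \<in> hom_polys n"
proof -
  obtain A B where A: "represents n A P" and B: "represents n B Q"
    using assms by (auto simp: hom_polys_def)
  have "represents n (\<lambda>v. A v + B v) (\<lambda>x. P x + Q x)"
    unfolding represents_def
  proof (intro conjI)
    have mA: "multilinear_form n A" and mB: "multilinear_form n B" using A B by (auto simp: represents_def)
    show "multilinear_form n (\<lambda>v. A v + B v)"
      unfolding multilinear_form_def
    proof (intro conjI allI impI)
      fix v w :: "nat \<Rightarrow> 'a" assume "\<forall>i<n. v i = w i"
      then have "A v = A w" "B v = B w" using mA mB by (auto simp: multilinear_form_def)
      then show "A v + B v = A w + B w" by simp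
    next
      fix i v assume "i < n"
      then have "Vector_Spaces.linear (*\<^sub>C) (*) (\<lambda>x. A (v(i := x)))"
        "Vector_Spaces.linear (*\<^sub>C) (*) (\<lambda>x. B (v(i := x)))"
        using mA mB by (auto simp: multilinear_form_def)
      then show "Vector_Spaces.linear (*\<^sub>C) (*) (\<lambda>x. A (v(i := x)) + B (v(i := x)))"
        by (simp add: Vector_Spaces.linear_iff distrib_left)
    qed
  qed (use A B in \<open>auto simp: represents_def symmetric_form_def intro: continuous_on_add\<close>)
  then show ?thesis by (auto simp: hom_polys_def)
qed

text \<open>On the unit sphere pointwise convergence implies weak-star convergence: a member of the
  completion is approximated by one finite tensor, on which the pairing is a finite sum of point
  values.\<close>

lemma poly_pairing_tendsto:
  fixes P :: "nat \<Rightarrow> 'a::complex_normed_vector \<Rightarrow> complex"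
  assumes P: "\<And>m. P m \<in> hom_polys n" "\<And>m. poly_norm (P m) = 1"
    and Q: "Q \<in> hom_polys n" "poly_norm Q = 1"
    and lim: "\<And>x. (\<lambda>m. P m x) \<longlonglongrightarrow> Q x"
    and U: "U \<in> completed_sym_tensors n"
  shows "(\<lambda>m. poly_pairing n (P m) U) \<longlonglongrightarrow> poly_pairing n Q U"
proof (rule metric_LIMSEQ_I)
  fix e :: real assume e: "e > 0"
  obtain u where u: "u \<in> cauchy_tensors n" "u \<in> U"
  proof -
    obtain w where w: "w \<in> cauchy_tensors n"
      and Uw: "U = {v. v \<in> cauchy_tensors n \<and> (\<lambda>k. proj_norm n (w k - v k)) \<longlonglongrightarrow> 0}"
      using U unfolding completed_sym_tensors_def by (auto elim!: quotientE)
    have "w k - w k = (\<lambda>_. 0)" for k by (simp add: fun_eq_iff)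
    then have "w \<in> U" using w by (simp add: Uw proj_norm_zero)
    then show ?thesis using w that by blast
  qed
  have sym: "u k \<in> sym_tensors n" for k using u(1) by (simp add: cauchy_tensors_def)
  have "e / 4 > 0" using e by simp
  then obtain N where "\<forall>k\<ge>N. \<forall>l\<ge>N. proj_norm n (u k - u l) < e / 4"
    using u(1) unfolding cauchy_tensors_def by blast
  then have N: "proj_norm n (u k - u l) < e / 4" if "N \<le> k" "N \<le> l" for k l
    using that by blast
  \<comment> \<open>The error of replacing the class by \<open>u N\<close> is uniform over all
    polynomials of norm \<open>1\<close>, so one \<open>N\<close> serves every \<open>P m\<close>
    and \<open>Q\<close>.\<close>
  have near: "cmod (poly_pairing n R U - u N (polar_form n R)) \<le> e / 4"
    if R: "R \<in> hom_polys n" "poly_norm R = 1" for R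
  proof (rule LIMSEQ_le_const2)
    show "(\<lambda>k. cmod (u k (polar_form n R) - u N (polar_form n R)))
            \<longlonglongrightarrow> cmod (poly_pairing n R U - u N (polar_form n R))"
      by (intro tendsto_intros poly_pairing_limit[OF R(1) U u(2)])
    have "cmod (u k (polar_form n R) - u N (polar_form n R)) \<le> e / 4" if "N \<le> k" for k
      using eval_tensor_bound[OF R(1) sym_tensors_diff[OF sym[of k] sym[of N]]] N[OF that order_refl] R(2)
      by simp
    then show "\<exists>M. \<forall>k\<ge>M. cmod (u k (polar_form n R) - u N (polar_form n R)) \<le> e / 4" by blast
  qed
  obtain k c x where uN: "u N = tensor_sum n k c x" using sym[of N] by (auto simp: sym_tensors_def)
  have "(\<lambda>m. u N (polar_form n (P m))) \<longlonglongrightarrow> u N (polar_form n Q)"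
    unfolding uN eval_tensor_sum[OF P(1)] eval_tensor_sum[OF Q(1)] by (intro tendsto_intros lim)
  then obtain M where M: "\<And>m. M \<le> m \<Longrightarrow> dist (u N (polar_form n (P m))) (u N (polar_form n Q)) < e / 4"
    using e metric_LIMSEQ_D[of _ _ "e / 4"] by (metis divide_pos_pos zero_less_numeral)
  have "dist (poly_pairing n (P m) U) (poly_pairing n Q U) < e" if "M \<le> m" for m
  proof -
    have "dist (poly_pairing n (P m) U) (u N (polar_form n (P m))) \<le> e / 4"
      using near[OF P(1) P(2), of m] by (simp add: dist_norm)
    moreover have "dist (poly_pairing n Q U) (u N (polar_form n Q)) \<le> e / 4"
      using near[OF Q] by (simp add: dist_norm)
    moreover note M[OF that]
    moreover have "dist (poly_pairing n (P m) U) (poly_pairing n Q U) \<le>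
        dist (poly_pairing n (P m) U) (u N (polar_form n (P m))) +
        dist (u N (polar_form n (P m))) (u N (polar_form n Q)) +
        dist (poly_pairing n Q U) (u N (polar_form n Q))"
      using dist_triangle[of "poly_pairing n (P m) U" "poly_pairing n Q U" "u N (polar_form n (P m))"]
        dist_triangle2[of "u N (polar_form n (P m))" "poly_pairing n Q U" "u N (polar_form n Q)"]
      by linarith
    ultimately show ?thesis using e by linarith
  qed
  then show "\<exists>M. \<forall>m\<ge>M. dist (poly_pairing n (P m) U) (poly_pairing n Q U) < e" by blast
qed

section \<open>Failure of the Kadec--Klee property\<close>

text \<open>The matrix with rows \<open>(cnj a, cnj b)\<close> and \<open>(- b, a)\<close> has
  orthogonal rows of equal length, so it is a multiple of a unitary one.\<close>

lemma rotation_identity: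
  fixes a b s t :: complex
  shows "(cmod (cnj a * s + cnj b * t))\<^sup>2 + (cmod (- b * s + a * t))\<^sup>2 =
    ((cmod a)\<^sup>2 + (cmod b)\<^sup>2) * ((cmod s)\<^sup>2 + (cmod t)\<^sup>2)"
proof -
  have "complex_of_real ((cmod (cnj a * s + cnj b * t))\<^sup>2 + (cmod (- b * s + a * t))\<^sup>2) =
    complex_of_real (((cmod a)\<^sup>2 + (cmod b)\<^sup>2) * ((cmod s)\<^sup>2 + (cmod t)\<^sup>2))"
    unfolding of_real_add of_real_mult complex_norm_square by (simp add: algebra_simps)
  then show ?thesis by (simp only: of_real_eq_iff)
qed

text \<open>The supremum of \<open>\<bar>\<psi>\<bar>\<^sup>2 + \<bar>\<rho>\<bar>\<^sup>2\<close> over the ball is approached along a sequence on which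
  \<open>(\<psi>, \<rho>)\<close> converges to some \<open>(a, b)\<close>; a unitary change of coordinates moves \<open>(a, b)\<close> to the first axis.\<close>

lemma touching_ellipsoid:
  fixes \<psi> \<rho> :: "'a::complex_normed_vector \<Rightarrow> complex"
  assumes \<psi>: "bounded_functional \<psi>" and \<rho>: "bounded_functional \<rho>"
    and x: "\<psi> x \<noteq> 0" and y: "\<psi> y = 0" "\<rho> y \<noteq> 0"
  shows "\<exists>(L :: 'a \<Rightarrow> complex) M z w. bounded_functional L \<and> bounded_functional M \<and>
    (\<forall>x. norm x \<le> 1 \<longrightarrow> (cmod (L x))\<^sup>2 + (cmod (M x))\<^sup>2 \<le> 1) \<and>
    (\<forall>k::nat. norm (z k) \<le> 1) \<and> (\<lambda>k. L (z k)) \<longlonglongrightarrow> 1 \<and> M w \<noteq> 0"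
proof -
  define N where "N x = (cmod (\<psi> x))\<^sup>2 + (cmod (\<rho> x))\<^sup>2" for x
  define S where "S = (SUP x\<in>cball 0 1. N x)"
  obtain K K' where K: "\<And>x. cmod (\<psi> x) \<le> K * norm x" and K': "\<And>x. cmod (\<rho> x) \<le> K' * norm x"
    using bounded_functional_bound[OF \<psi>] bounded_functional_bound[OF \<rho>] by blast
  have K_ball: "cmod (\<psi> x) \<le> \<bar>K\<bar>" "cmod (\<rho> x) \<le> \<bar>K'\<bar>" if "norm x \<le> 1" for x
  proof -
    have "K * norm x \<le> \<bar>K\<bar> * 1" "K' * norm x \<le> \<bar>K'\<bar> * 1" using that by (intro mult_mono; simp)+
    then show "cmod (\<psi> x) \<le> \<bar>K\<bar>" "cmod (\<rho> x) \<le> \<bar>K'\<bar>"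
      using order_trans[OF K[of x]] order_trans[OF K'[of x]] by auto
  qed
  have bdd: "bdd_above (N ` cball 0 1)"
    using K_ball unfolding N_def
    by (intro bdd_aboveI2[where M = "\<bar>K\<bar>\<^sup>2 + \<bar>K'\<bar>\<^sup>2"] add_mono power_mono) auto
  have le_S: "N u \<le> S" if "norm u \<le> 1" for u
    unfolding S_def using that bdd by (intro cSUP_upper) auto
  have "x \<noteq> 0" using x bounded_functional_scaleR[OF \<psi>, of 0 0] by auto
  then have "norm ((1 / norm x) *\<^sub>R x) \<le> 1" "N ((1 / norm x) *\<^sub>R x) > 0"
    using x by (simp_all add: N_def bounded_functional_scaleR[OF \<psi>] add_pos_nonneg)
  then have S_pos: "S > 0" using le_S less_le_trans by blast
  have "\<exists>z. norm z \<le> 1 \<and> S - 1 / real (Suc k) < N z" for k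
  proof -
    have "S - 1 / real (Suc k) < S" by simp
    then obtain z where "z \<in> cball 0 1" "S - 1 / real (Suc k) < N z"
      using less_cSUP_iff[OF _ bdd] unfolding S_def by (metis cball_eq_empty not_one_less_zero)
    then show ?thesis by auto
  qed
  then obtain z where z: "\<And>k. norm (z k) \<le> 1" "\<And>k. S - 1 / real (Suc k) < N (z k)" by metis
  have N_lim: "(\<lambda>k. N (z k)) \<longlonglongrightarrow> S"
  proof (rule tendsto_sandwich[OF always_eventually always_eventually])
    show "(\<lambda>k. S - 1 / real (Suc k)) \<longlonglongrightarrow> S"
      using tendsto_diff[OF tendsto_const LIMSEQ_inverse_real_of_nat, of S]
      by (simp add: inverse_eq_divide)
    show "(\<lambda>k. S) \<longlonglongrightarrow> S" by simp
  qed (use z le_S in \<open>auto intro: less_imp_le\<close>)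
  \<comment> \<open>The supremum \<open>S\<close> need not be attained on the ball; compactness is
    used in the plane of values \<open>(\<psi>, \<rho>)\<close> instead.\<close>
  have "seq_compact (cball (0::complex) \<bar>K\<bar> \<times> cball (0::complex) \<bar>K'\<bar>)"
    by (intro compact_imp_seq_compact compact_Times compact_cball)
  moreover have "\<forall>k. (\<psi> (z k), \<rho> (z k)) \<in> cball 0 \<bar>K\<bar> \<times> cball 0 \<bar>K'\<bar>"
    using K_ball z(1) by simp
  ultimately obtain l r where r: "strict_mono (r :: nat \<Rightarrow> nat)"
    and lim: "((\<lambda>k. (\<psi> (z k), \<rho> (z k))) \<circ> r) \<longlonglongrightarrow> l"
    by (rule seq_compactE)
  define a b where "a = fst l" "b = snd l"
  have lim\<psi>: "(\<lambda>k. \<psi> (z (r k))) \<longlonglongrightarrow> a" and lim\<rho>: "(\<lambda>k. \<rho> (z (r k))) \<longlonglongrightarrow> b"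
    using tendsto_fst[OF lim] tendsto_snd[OF lim] by (simp_all add: o_def a_b_def)
  have "(\<lambda>k. N (z (r k))) \<longlonglongrightarrow> (cmod a)\<^sup>2 + (cmod b)\<^sup>2"
    unfolding N_def by (intro tendsto_intros lim\<psi> lim\<rho>)
  moreover have "(\<lambda>k. N (z (r k))) \<longlonglongrightarrow> S"
    using LIMSEQ_subseq_LIMSEQ[OF N_lim r] by (simp add: o_def)
  ultimately have S: "(cmod a)\<^sup>2 + (cmod b)\<^sup>2 = S" by (rule LIMSEQ_unique)
  have S_complex: "cnj a * a + cnj b * b = complex_of_real S"
    unfolding S[symmetric] of_real_add complex_norm_square by (simp add: mult.commute)
  \<comment> \<open>The rotation multiplies sums of squares by \<open>S\<close>, and these are at
    most \<open>S\<close> on the ball; dividing by \<open>S\<close> makes the bound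
    \<open>1\<close>, and it sends \<open>(a, b)\<close> to \<open>(1, 0)\<close>.\<close>
  define L where "L x = (cnj a / S) * \<psi> x + (cnj b / S) * \<rho> x" for x
  define M where "M x = (- b / S) * \<psi> x + (a / S) * \<rho> x" for x
  have "(cmod (L x))\<^sup>2 + (cmod (M x))\<^sup>2 \<le> 1" if "norm x \<le> 1" for x
  proof -
    have "L x = (cnj a * \<psi> x + cnj b * \<rho> x) / S" "M x = (- b * \<psi> x + a * \<rho> x) / S"
      by (simp_all add: L_def M_def add_divide_distrib diff_divide_distrib)
    then have "(cmod (L x))\<^sup>2 = (cmod (cnj a * \<psi> x + cnj b * \<rho> x))\<^sup>2 / S\<^sup>2"
      "(cmod (M x))\<^sup>2 = (cmod (- b * \<psi> x + a * \<rho> x))\<^sup>2 / S\<^sup>2"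
      by (simp_all only: norm_divide power_divide norm_of_real power2_abs)
    then have "(cmod (L x))\<^sup>2 + (cmod (M x))\<^sup>2 = ((cmod (cnj a * \<psi> x + cnj b * \<rho> x))\<^sup>2 +
        (cmod (- b * \<psi> x + a * \<rho> x))\<^sup>2) / S\<^sup>2"
      by (simp only: add_divide_distrib)
    also have "\<dots> = S * N x / S\<^sup>2" unfolding rotation_identity S N_def ..
    also have "\<dots> = N x / S" using S_pos by (simp add: power2_eq_square)
    also have "\<dots> \<le> 1" using le_S[OF that] S_pos by simp
    finally show ?thesis .
  qed
  moreover have "(\<lambda>k. L (z (r k))) \<longlonglongrightarrow> 1"
  proof -
    have "(\<lambda>k. L (z (r k))) \<longlonglongrightarrow> (cnj a / S) * a + (cnj b / S) * b"
      unfolding L_def by (intro tendsto_intros lim\<psi> lim\<rho>)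
    moreover have "(cnj a / S) * a + (cnj b / S) * b = (cnj a * a + cnj b * b) / S"
      by (simp add: add_divide_distrib)
    ultimately show ?thesis using S_complex S_pos by simp
  qed
  moreover obtain w where "M w \<noteq> 0"
  proof (rule ccontr)
    assume "\<not> thesis"
    then have M: "M w = 0" for w using that by blast
    \<comment> \<open>Here the independence of the functionals enters: \<open>y\<close> isolates
      \<open>\<rho>\<close> and gives \<open>a = 0\<close>, then \<open>x\<close> gives
      \<open>b = 0\<close>, against \<open>S > 0\<close>.\<close>
    have "a = 0" using M[of y] y S_pos by (simp add: M_def)
    moreover from this have "b = 0" using M[of x] x S_pos by (simp add: M_def)
    ultimately show False using S S_pos by simp
  qed
  moreover have "bounded_functional L" "bounded_functional M"
    unfolding L_def M_def by (intro bounded_functional_combination \<psi> \<rho>)+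
  ultimately show ?thesis
    using z(1)
    by - (rule exI[of _ L], rule exI[of _ M], rule exI[of _ "\<lambda>k. z (r k)"], rule exI[of _ w], auto)
qed

section \<open>Norms of polynomials and the sequence violating the property\<close>

lemma poly_norm_le: "(\<And>x. norm x \<le> 1 \<Longrightarrow> cmod (P x) \<le> c) \<Longrightarrow> poly_norm P \<le> c"
  unfolding poly_norm_def by (intro cSUP_least) auto

lemma poly_norm_ge: "P \<in> hom_polys n \<Longrightarrow> norm x \<le> 1 \<Longrightarrow> cmod (P x) \<le> poly_norm P"
  unfolding poly_norm_def by (intro cSUP_upper bdd_above_poly_norm) auto

lemma poly_norm_eq_1:
  assumes P: "P \<in> hom_polys n" and le: "\<And>x. norm x \<le> 1 \<Longrightarrow> cmod (P x) \<le> 1"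
    and z: "\<And>k. norm (z k) \<le> 1" "(\<lambda>k. cmod (P (z k))) \<longlonglongrightarrow> 1"
  shows "poly_norm P = 1"
proof (rule antisym)
  show "1 \<le> poly_norm P"
    using poly_norm_ge[OF P z(1)] by (intro LIMSEQ_le_const2[OF z(2)]) auto
qed (rule poly_norm_le[OF le])

theorem theorem5p4:
  fixes n :: nat
  assumes "\<not> (\<exists>B :: 'a::complex_banach set. finite B \<and> module.span scaleC B = UNIV)"
    and "n \<ge> 3"
  shows "\<not> sequential_wstar_KK (hom_polys n :: ('a \<Rightarrow> complex) set) poly_norm
             (completed_sym_tensors n) (poly_pairing n)"
proof
  assume KK: "sequential_wstar_KK (hom_polys n :: ('a \<Rightarrow> complex) set) poly_norm
             (completed_sym_tensors n) (poly_pairing n)"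
  note inf = infinite_real_dimension[OF assms(1)]
  obtain f :: "nat \<Rightarrow> 'a \<Rightarrow>\<^sub>L real" where "\<And>n. norm (f n) \<le> 1" "\<And>m n. m \<noteq> n \<Longrightarrow> 1 \<le> norm (f m - f n)"
    using separated_functionals[OF inf] by blast
  then obtain c and g :: "nat \<Rightarrow> 'a \<Rightarrow>\<^sub>L real" where "weak_star_null c g"
    using josefson_nissenzweig by blast
  then have c: "0 < c" and g: "\<And>m. norm (g m) \<le> 1" "\<And>m. c \<le> norm (g m)"
    and g_null: "\<And>x. (\<lambda>m. blinfun_apply (g m) x) \<longlonglongrightarrow> 0"
    by (auto simp: weak_star_null_def)
  define \<phi> where "\<phi> m = complexify (g m)" for m
  have \<phi>: "bounded_functional (\<phi> m)" for m by (simp add: \<phi>_def bounded_functional_complexify)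
  have \<phi>_null: "(\<lambda>m. \<phi> m x) \<longlonglongrightarrow> 0" for x unfolding \<phi>_def by (rule tendsto_complexify[OF g_null])
  have \<phi>_le: "cmod (\<phi> m x) \<le> 1" if "norm x \<le> 1" for m x
    using cmod_complexify_le[of "g m" x] mult_mono[OF g(1)[of m] that] by (simp add: \<phi>_def)
  have "\<exists>x. norm x \<le> 1 \<and> c / 2 \<le> cmod (\<phi> m x)" for m
  proof -
    obtain x where x: "norm x \<le> 1" "norm (g m) / 2 \<le> \<bar>blinfun_apply (g m) x\<bar>"
      using blinfun_half_norm_attained by blast
    have "\<bar>blinfun_apply (g m) x\<bar> \<le> cmod (\<phi> m x)"
      using abs_Re_le_cmod[of "\<phi> m x"] by (simp add: \<phi>_def complexify_def)
    then show ?thesis using x g(2)[of m] by (intro exI[of _ x]) auto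
  qed
  then obtain p where p: "\<And>m. norm (p m) \<le> 1" "\<And>m. c / 2 \<le> cmod (\<phi> m (p m))" by metis

  \<comment> \<open>With no functionals to annihilate, \<open>common_kernel\<close> just supplies a
    nonzero vector.\<close>
  obtain x :: 'a where "x \<noteq> 0" using common_kernel[OF inf, of "\<lambda>_ _. 0" 0] by (auto simp: linear_iff)
  then obtain h :: "'a \<Rightarrow>\<^sub>L real" where h: "blinfun_apply h x \<noteq> 0"
    using norming_functional[of x] by (metis norm_eq_zero)
  have linear_i: "linear (\<lambda>x. blinfun_apply h (\<i> *\<^sub>C x))"
    by (rule linearI) (simp_all add: scaleC_add_right blinfun.add_right scaleC_of_real[symmetric]
        scaleC_scaleC mult.commute[of \<i>], simp add: scaleC_scaleC[symmetric] scaleC_of_real blinfun.scaleR_right)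
  \<comment> \<open>Both real and imaginary part of \<open>complexify h\<close> vanish at
    \<open>y\<close>, so a functional nonzero at \<open>y\<close> gives an independent
    partner.\<close>
  obtain y where y: "y \<noteq> 0" "blinfun_apply h y = 0" "blinfun_apply h (\<i> *\<^sub>C y) = 0"
  proof -
    define H where "H i = (if i = 0 then blinfun_apply h else (\<lambda>x. blinfun_apply h (\<i> *\<^sub>C x)))"
      for i :: nat
    have "linear (H i)" for i
      using linear_i by (simp add: H_def bounded_linear.linear blinfun.bounded_linear_right)
    then obtain y where "y \<noteq> 0" "\<forall>i<2. H i y = 0" using common_kernel[OF inf, of H 2] by blast
    then show ?thesis using that[of y] by (auto simp: H_def less_2_cases_iff)
  qed
  obtain h' :: "'a \<Rightarrow>\<^sub>L real" where h': "blinfun_apply h' y \<noteq> 0"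
    using norming_functional[of y] y(1) by (metis norm_eq_zero)
  obtain L M and z :: "nat \<Rightarrow> 'a" and w where L: "bounded_functional L" and M: "bounded_functional M"
    and ball: "\<And>x. norm x \<le> 1 \<Longrightarrow> (cmod (L x))\<^sup>2 + (cmod (M x))\<^sup>2 \<le> 1"
    and z: "\<And>k. norm (z k) \<le> 1" "(\<lambda>k. L (z k)) \<longlonglongrightarrow> 1" and w: "M w \<noteq> 0"
    using touching_ellipsoid[OF bounded_functional_complexify bounded_functional_complexify,
        of h x y h'] h h' y by (auto simp: complexify_def complex_eq_iff)
  have L_le: "cmod (L x) \<le> 1" if "norm x \<le> 1" for x
  proof -
    have "(cmod (L x))\<^sup>2 \<le> 1" using ball[OF that] zero_le_power2[of "cmod (M x)"] by linarith
    then show ?thesis by (simp add: abs_square_le_1)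
  qed

  \<comment> \<open>The exponent left for \<open>\<phi> m\<close>; it is positive because
    \<open>n \<ge> 3\<close>, and only then do the perturbations vanish pointwise.\<close>
  define k where "k = n - 2"
  have n: "n = Suc (Suc k)" and k: "k > 0" using assms(2) by (simp_all add: k_def)
  define Q where "Q m x = (M x)\<^sup>2 * \<phi> m x ^ k" for m x
  define P0 where "P0 x = L x ^ n" for x
  define P where "P m x = P0 x + Q m x" for m x
  have P0_mem: "P0 \<in> hom_polys n"
    using product_hom_polys[of "\<lambda>_. L" n] L by (simp add: P0_def[abs_def])
  have Q_mem: "Q m \<in> hom_polys n" for m
  proof -
    have "bounded_functional (if i < 2 then M else \<phi> m)" for i :: nat
      using M \<phi> by simp
    from product_hom_polys[of "\<lambda>i. if i < 2 then M else \<phi> m", OF this, of n]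
    have "(\<lambda>x. \<Prod>i<n. (if i < 2 then M else \<phi> m) x) \<in> hom_polys n" .
    moreover have "(\<Prod>i<n. (if i < 2 then M else \<phi> m) x) = Q m x" for x
      by (simp add: Q_def n prod.lessThan_Suc_shift power2_eq_square mult.assoc del: prod.lessThan_Suc)
    ultimately show ?thesis by simp
  qed
  have P_mem: "P m \<in> hom_polys n" for m
    using hom_polys_add[OF P0_mem Q_mem] by (simp add: P_def[abs_def])
  \<comment> \<open>Lowering the exponent to \<open>2\<close> is allowed since
    \<open>cmod (L x) \<le> 1\<close>; the squares then fit the ellipsoid bound.\<close>
  have P0_le: "cmod (P0 x) \<le> (cmod (L x))\<^sup>2" if "norm x \<le> 1" for x
    unfolding P0_def norm_power using L_le[OF that] by (intro power_decreasing) (auto simp: n)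
  have Q_le: "cmod (Q m x) \<le> (cmod (M x))\<^sup>2" if "norm x \<le> 1" for m x
    using \<phi>_le[OF that, of m] by (simp add: Q_def norm_mult norm_power mult_left_le power_le_one)
  have P0_lim: "(\<lambda>j. P0 (z j)) \<longlonglongrightarrow> 1"
    using tendsto_power[OF z(2), of n] by (simp add: P0_def)
  \<comment> \<open>Where \<open>L\<close> tends to \<open>1\<close> the ellipsoid leaves no room
    for \<open>M\<close>, so along \<open>z\<close> the perturbation dies and the norm stays equal
    to \<open>1\<close>.\<close>
  have M_lim: "(\<lambda>j. (cmod (M (z j)))\<^sup>2) \<longlonglongrightarrow> 0"
  proof (rule Lim_null_comparison)
    show "eventually (\<lambda>j. norm ((cmod (M (z j)))\<^sup>2) \<le> 1 - (cmod (L (z j)))\<^sup>2) sequentially"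
      using ball z(1) by (simp add: algebra_simps)
    have "(\<lambda>j. 1 - (cmod (L (z j)))\<^sup>2) \<longlonglongrightarrow> 1 - (cmod 1)\<^sup>2" by (intro tendsto_intros z(2))
    then show "(\<lambda>j. 1 - (cmod (L (z j)))\<^sup>2) \<longlonglongrightarrow> 0" by simp
  qed
  have Q_lim: "(\<lambda>j. Q m (z j)) \<longlonglongrightarrow> 0" for m
    by (rule Lim_null_comparison[OF _ M_lim]) (simp add: Q_le z(1))
  have P0_norm: "poly_norm P0 = 1"
  proof (rule poly_norm_eq_1[OF P0_mem _ z(1)])
    show "cmod (P0 x) \<le> 1" if "norm x \<le> 1" for x
      using P0_le[OF that] ball[OF that] zero_le_power2[of "cmod (M x)"] by linarith
    show "(\<lambda>j. cmod (P0 (z j))) \<longlonglongrightarrow> 1" using tendsto_norm[OF P0_lim] by simp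
  qed
  have P_norm: "poly_norm (P m) = 1" for m
  proof (rule poly_norm_eq_1[OF P_mem _ z(1)])
    show "cmod (P m x) \<le> 1" if "norm x \<le> 1" for x
      using P0_le[OF that] Q_le[OF that, of m] ball[OF that] norm_triangle_ineq[of "P0 x" "Q m x"]
      unfolding P_def by linarith
    show "(\<lambda>j. cmod (P m (z j))) \<longlonglongrightarrow> 1"
      using tendsto_norm[OF tendsto_add[OF P0_lim Q_lim]] by (simp add: P_def)
  qed
  have P_lim: "(\<lambda>m. P m x) \<longlonglongrightarrow> P0 x" for x
  proof -
    have "(\<lambda>m. P m x) \<longlonglongrightarrow> P0 x + (M x)\<^sup>2 * 0 ^ k"
      unfolding P_def Q_def by (intro tendsto_intros \<phi>_null)
    moreover have "P0 x + (M x)\<^sup>2 * 0 ^ k = P0 x" using k by simp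
    ultimately show ?thesis by (simp only:)
  qed
  have "(\<lambda>m. poly_norm (P m - P0)) \<longlonglongrightarrow> 0"
    using KK[unfolded sequential_wstar_KK_def, rule_format, of P P0]
      P_mem P0_mem P_norm P0_norm poly_pairing_tendsto[OF P_mem P_norm P0_mem P0_norm P_lim] by blast
  moreover have "P m - P0 = Q m" for m by (simp add: fun_eq_iff P_def)
  ultimately have Q_null: "(\<lambda>m. poly_norm (Q m)) \<longlonglongrightarrow> 0" by simp

  \<comment> \<open>It remains to bound \<open>Q m\<close> from below. \<open>\<phi> m\<close> is
    large at \<open>p m\<close>, where \<open>M\<close> may vanish; \<open>M\<close> is nonzero at
    \<open>y'\<close>, where \<open>\<phi> m\<close> is eventually small. Midpoints of
    \<open>p m\<close> with \<open>y'\<close> or \<open>- y'\<close> combine the two.\<close>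
  define y' where "y' = (1 / norm w) *\<^sub>R w"
  have "w \<noteq> 0" using w bounded_functional_scaleR[OF M, of 0 0] by auto
  then have y': "norm y' \<le> 1" "M y' \<noteq> 0"
    using w by (simp_all add: y'_def bounded_functional_scaleR[OF M])
  \<comment> \<open>At such midpoints \<open>\<phi> m\<close> keeps at least
    \<open>(c / 2 - c / 4) / 2 = c / 8\<close>, and \<open>M\<close> reaches half of its size at
    \<open>y'\<close> for one of the signs.\<close>
  define \<eta> where "\<eta> = (cmod (M y') / 2)\<^sup>2 * (c / 8) ^ k"
  have "\<eta> > 0" using y' c by (simp add: \<eta>_def)
  have "eventually (\<lambda>m. cmod (\<phi> m y') < c / 4) sequentially"
    using tendsto_norm[OF \<phi>_null[of y']] c by (intro order_tendstoD) auto
  moreover have "eventually (\<lambda>m. poly_norm (Q m) < \<eta>) sequentially"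
    using Q_null \<open>\<eta> > 0\<close> by (intro order_tendstoD) auto
  ultimately have "eventually (\<lambda>m. cmod (\<phi> m y') < c / 4 \<and> poly_norm (Q m) < \<eta>) sequentially"
    by (rule eventually_conj)
  then obtain m where m: "cmod (\<phi> m y') < c / 4" "poly_norm (Q m) < \<eta>"
    by (auto simp: eventually_sequentially)
  define q where "q s = (1 / 2) *\<^sub>R (p m + s *\<^sub>R y')" for s :: real
  have q: "norm (q s) \<le> 1" "c / 8 \<le> cmod (\<phi> m (q s))" if "\<bar>s\<bar> = 1" for s
  proof -
    have "norm (s *\<^sub>R y') \<le> 1" using that y'(1) by simp
    then show "norm (q s) \<le> 1"
      using norm_triangle_ineq[of "p m" "s *\<^sub>R y'"] p(1)[of m] by (simp add: q_def)
    have "\<phi> m (q s) = (\<phi> m (p m) + complex_of_real s * \<phi> m y') / 2"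
      by (simp add: q_def bounded_functional_scaleR[OF \<phi>] bounded_functional_add[OF \<phi>])
    then have "cmod (\<phi> m (q s)) = cmod (\<phi> m (p m) + complex_of_real s * \<phi> m y') / 2"
      by (simp only: norm_divide norm_numeral)
    moreover have "cmod (complex_of_real s * \<phi> m y') < c / 4" using m(1) that by (simp add: norm_mult)
    then have "c / 4 \<le> cmod (\<phi> m (p m) + complex_of_real s * \<phi> m y')"
      using norm_diff_ineq[of "\<phi> m (p m)" "complex_of_real s * \<phi> m y'"] p(2)[of m] by linarith
    ultimately show "c / 8 \<le> cmod (\<phi> m (q s))" by linarith
  qed
  have M_q: "M (q s) = (M (p m) + complex_of_real s * M y') / 2" for s
    by (simp add: q_def bounded_functional_scaleR[OF M] bounded_functional_add[OF M])
  \<comment> \<open>The values for the two signs differ by \<open>M y'\<close>, so one of them has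
    at least half its modulus.\<close>
  have "M (q 1) - M (q (- 1)) = M y'"
    unfolding M_q diff_divide_distrib[symmetric] by simp
  then have "cmod (M y') \<le> cmod (M (q 1)) + cmod (M (q (- 1)))"
    using norm_triangle_ineq4[of "M (q 1)" "M (q (- 1))"] by simp
  then obtain s :: real where s: "\<bar>s\<bar> = 1" "cmod (M y') / 2 \<le> cmod (M (q s))"
    using that[of 1] that[of "- 1"] by (cases "cmod (M y') / 2 \<le> cmod (M (q 1))") auto
  have "\<eta> \<le> (cmod (M (q s)))\<^sup>2 * cmod (\<phi> m (q s)) ^ k"
    unfolding \<eta>_def using s q(2)[OF s(1)] c by (intro mult_mono power_mono) auto
  also have "\<dots> = cmod (Q m (q s))" by (simp add: Q_def norm_mult norm_power)
  also have "\<dots> \<le> poly_norm (Q m)" by (rule poly_norm_ge[OF Q_mem q(1)[OF s(1)]])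
  finally show False using m(2) by simp
qed

end
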